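(* Let $\Omega\subseteq\mathbb{R}^n$ be open and bounded, let $f\colon\Omega\to\mathbb{R}$ be continuous, and let $F\colon\mathcal{S}^n\to\overline{\mathbb{R}}$ be such that $(X,x)\mapsto F(X)-f(x)$ is elliptic at $0$ with $\partial\Theta_+(x)=\partial\Theta_-(x)\neq\emptyset$ for all $x\in\Omega$. Suppose that for every $x_0\in\Omega$ and every sequence $X_k\in\mathcal{S}^n$ with $F(X_k)\to f(x_0)$ one has $$\liminf_{k\to\infty}F(X_k+\tau I)>f(x_0)\qquad\text{for all }\tau>0.$$ Then the comparison principle holds for the equation $F(\mathcal{H}w)=f(x)$ in $\Omega$.
   Context: $\mathcal{S}^n$ is the space of real symmetric $n\times n$ matrices with its usual partial order ($X\le Y$ iff $Y-X$ is positive semidefinite), $\overline{\mathbb{R}}=\mathbb{R}\cup\{-\infty,\infty\}$, and $\mathcal{H}w$ is the Hessian matrix of $w$. Write $G(X,x):=F(X)-f(x)$. $G$ is elliptic at $0$ if for all $x\in\Omega$ and $X\le Y$ in $\mathcal{S}^n$: $0\le G(X,x)$ implies $0\le G(Y,x)$, and $0<G(X,x)$ implies $0<G(Y,x)$. $\Theta_-(x):=\{X\in\mathcal{S}^n : G(X,x)\le0\}$ and $\Theta_+(x):=\{X\in\mathcal{S}^n : G(X,x)\ge0\}$; $\partial$ is the topological boundary in $\mathcal{S}^n$. Viscosity solutions: $v\in USC(\overline\Omega)$ is a viscosity subsolution of $F(\mathcal{H}w)=f(x)$ in $\Omega$ if, whenever $x_0\in\Omega$ and $\phi$ is a $C^2$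 function near $x_0$ with $\phi(x_0)=v(x_0)$ and $\phi\ge v$ near $x_0$, then $G(\mathcal{H}\phi(x_0),x_0)\ge0$. $u\in LSC(\overline\Omega)$ is a viscosity supersolution if, whenever $\phi$ is $C^2$ near $x_0\in\Omega$ with $\phi(x_0)=u(x_0)$ and $\phi\le u$ near $x_0$, then $G(\mathcal{H}\phi(x_0),x_0)\le0$. ($USC$, $LSC$: real-valued upper/lower semicontinuous functions.) The comparison principle holds for the equation in $\Omega$ if: whenever $v\in USC(\overline\Omega)$ is a viscosity subsolution and $u\in LSC(\overline\Omega)$ is a viscosity supersolution in $\Omega$ with $v\le u$ on $\partial\Omega$, then $v\le u$ in $\Omega$. *)

theory Defs
  imports "HOL-Analysis.Analysis"
begin

definition sym_matrices :: "(real ^ 'n ^ 'n) set" where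
  "sym_matrices = {X. transpose X = X}"

(* The order on symmetric matrices. The library's order on real ^ 'n ^ 'n is the
   componentwise one and is not used. *)
definition psd_le :: "real ^ 'n ^ 'n \<Rightarrow> real ^ 'n ^ 'n \<Rightarrow> bool" where
  "psd_le X Y \<longleftrightarrow> (\<forall>\<xi>. 0 \<le> \<xi> \<bullet> ((Y - X) *v \<xi>))"

definition partial_derivative :: "'n \<Rightarrow> (real ^ 'n \<Rightarrow> real) \<Rightarrow> real ^ 'n \<Rightarrow> real" where
  "partial_derivative i \<phi> x = frechet_derivative \<phi> (at x) (axis i 1)"

definition hessian :: "(real ^ 'n \<Rightarrow> real) \<Rightarrow> real ^ 'n \<Rightarrow> real ^ 'n ^ 'n" where
  "hessian \<phi> x = (\<chi> i j. partial_derivative i (partial_derivative j \<phi>) x)"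

definition C2_near :: "(real ^ 'n \<Rightarrow> real) \<Rightarrow> real ^ 'n \<Rightarrow> bool" where
  "C2_near \<phi> x0 \<longleftrightarrow> (\<exists>U. open U \<and> x0 \<in> U \<and>
     (\<forall>x\<in>U. \<phi> differentiable (at x)) \<and>
     (\<forall>i. \<forall>x\<in>U. partial_derivative i \<phi> differentiable (at x)) \<and>
     (\<forall>i j. continuous_on U (partial_derivative i (partial_derivative j \<phi>))))"

definition usc_on :: "'a::topological_space set \<Rightarrow> ('a \<Rightarrow> real) \<Rightarrow> bool" where
  "usc_on S v \<longleftrightarrow> (\<forall>x\<in>S. \<forall>a. v x < a \<longrightarrow> (\<forall>\<^sub>F y in at x within S. v y < a))"

definition lsc_on :: "'a::topological_space set \<Rightarrow> ('a \<Rightarrow> real) \<Rightarrow> bool" where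
  "lsc_on S u \<longleftrightarrow> (\<forall>x\<in>S. \<forall>a. a < u x \<longrightarrow> (\<forall>\<^sub>F y in at x within S. a < u y))"

(* The function G. A map F on the symmetric matrices is given as a total function on
   real ^ 'n ^ 'n; it is only ever evaluated at symmetric matrices,
   since the Hessian of a C^2 function is symmetric. *)
definition eq_op :: "(real ^ 'n ^ 'n \<Rightarrow> ereal) \<Rightarrow> (real ^ 'n \<Rightarrow> real) \<Rightarrow>
    real ^ 'n ^ 'n \<Rightarrow> real ^ 'n \<Rightarrow> ereal" where
  "eq_op F f X x = F X - ereal (f x)"

definition elliptic_at_0 ::
    "(real ^ 'n) set \<Rightarrow> (real ^ 'n ^ 'n \<Rightarrow> real ^ 'n \<Rightarrow> ereal) \<Rightarrow> bool" where
  "elliptic_at_0 \<Omega> G \<longleftrightarrow>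
     (\<forall>x\<in>\<Omega>. \<forall>X\<in>sym_matrices. \<forall>Y\<in>sym_matrices. psd_le X Y \<longrightarrow>
        (0 \<le> G X x \<longrightarrow> 0 \<le> G Y x) \<and> (0 < G X x \<longrightarrow> 0 < G Y x))"

definition Theta_minus ::
    "(real ^ 'n ^ 'n \<Rightarrow> real ^ 'n \<Rightarrow> ereal) \<Rightarrow> real ^ 'n \<Rightarrow> (real ^ 'n ^ 'n) set" where
  "Theta_minus G x = {X \<in> sym_matrices. G X x \<le> 0}"

definition Theta_plus ::
    "(real ^ 'n ^ 'n \<Rightarrow> real ^ 'n \<Rightarrow> ereal) \<Rightarrow> real ^ 'n \<Rightarrow> (real ^ 'n ^ 'n) set" where
  "Theta_plus G x = {X \<in> sym_matrices. 0 \<le> G X x}"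

(* The boundary relative to the space of symmetric matrices, which has empty interior in
   real ^ 'n ^ 'n unless n = 1. *)
definition sym_boundary :: "(real ^ 'n ^ 'n) set \<Rightarrow> (real ^ 'n ^ 'n) set" where
  "sym_boundary A = top_of_set sym_matrices frontier_of A"

definition viscosity_subsolution ::
    "(real ^ 'n) set \<Rightarrow> (real ^ 'n ^ 'n \<Rightarrow> ereal) \<Rightarrow> (real ^ 'n \<Rightarrow> real) \<Rightarrow>
     (real ^ 'n \<Rightarrow> real) \<Rightarrow> bool" where
  "viscosity_subsolution \<Omega> F f v \<longleftrightarrow> usc_on (closure \<Omega>) v \<and>
     (\<forall>x0\<in>\<Omega>. \<forall>\<phi>. C2_near \<phi> x0 \<and> \<phi> x0 = v x0 \<and> (\<forall>\<^sub>F x in nhds x0. v x \<le> \<phi> x)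
        \<longrightarrow> 0 \<le> eq_op F f (hessian \<phi> x0) x0)"

definition viscosity_supersolution ::
    "(real ^ 'n) set \<Rightarrow> (real ^ 'n ^ 'n \<Rightarrow> ereal) \<Rightarrow> (real ^ 'n \<Rightarrow> real) \<Rightarrow>
     (real ^ 'n \<Rightarrow> real) \<Rightarrow> bool" where
  "viscosity_supersolution \<Omega> F f u \<longleftrightarrow> lsc_on (closure \<Omega>) u \<and>
     (\<forall>x0\<in>\<Omega>. \<forall>\<phi>. C2_near \<phi> x0 \<and> \<phi> x0 = u x0 \<and> (\<forall>\<^sub>F x in nhds x0. \<phi> x \<le> u x)
        \<longrightarrow> eq_op F f (hessian \<phi> x0) x0 \<le> 0)"

definition comparison_principle ::
    "(real ^ 'n) set \<Rightarrow> (real ^ 'n ^ 'n \<Rightarrow> ereal) \<Rightarrow> (real ^ 'n \<Rightarrow> real) \<Rightarrow> bool" where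
  "comparison_principle \<Omega> F f \<longleftrightarrow>
     (\<forall>v u. viscosity_subsolution \<Omega> F f v \<and> viscosity_supersolution \<Omega> F f u \<and>
        (\<forall>x\<in>frontier \<Omega>. v x \<le> u x) \<longrightarrow> (\<forall>x\<in>\<Omega>. v x \<le> u x))"

end

(* Perturb the subsolution to v + tau/2 |x|^2 and regularise by sup- and inf-convolution with
   parameter a. Between the regularised functions, up to a small tilt p, one can insert a
   function g with second differences bounded by a |h|^2; it depends only on the subsolution.
   The contact points x(p) satisfy |p - q| <= 4 a |x(p) - x(q)|, so together they do not form a null
   set. A telescoping energy estimate shows that at almost every point g is, on some arbitrarily
   small ball of radius r, within delta r^2 of a quadratic polynomial. This replaces Alexandrov's
   theorem: after adding a small multiple of |x|^2 the polynomial touches both functions near the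
   contact point, so that one symmetric matrix X serves, up to multiples of the identity,
   for both. As a tends to infinity this gives Z_k, s_k, t_k with s_k and t_k tending to some x0 in
   Omega and, by ellipticity,
     f(s_k) <= F(Z_k) <= f(t_k)  and  F(Z_k + tau/2 I) <= f(t_k),
   contradicting the hypothesis on the lower limit at x0. *)

theory Submission
  imports Defs
begin

section \<open>Functions with vanishing third differences\<close>

text \<open>\<open>F\<close> may jump and take infinite values, and nothing bounds the matrices that
  arise as a grows, so no limit matrix is available. The hypothesis speaks of arbitrary sequences,
  however, so it is enough to control the values of \<open>F\<close> along the sequence. What must
  be exact is the relation between the two Hessians. Both come from one X, shifted by the multiples
  \<tau>/4 - \<tau> (subsolution) and -\<tau>/4 (supersolution) of the identity: \<tau>/4 on each
  side pays for the approximation, and \<tau>/2 of the perturbation survives as the strict gap.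
  Sup-convolutions have second differences bounded from below only. The energy estimate requires a
  bound from both sides, hence the interposed function. Dyadic scales are used because a difference
  quotient at one scale is then an average of those at the next. The tilts are there because a
  single contact point could lie in the exceptional null set.\<close>

lemma additive_continuous_imp_linear:
  fixes L :: "'a::real_normed_vector \<Rightarrow> real"
  assumes add: "\<And>x y. L (x + y) = L x + L y" and cont: "continuous_on UNIV L"
  shows "linear L"
proof (rule linearI)
  fix t :: real and x
  have nat: "L (of_nat n *\<^sub>R y) = of_nat n * L y" for n y
  proof (induction n)
    case 0
    then show ?case using add[of 0 0] by simp
  next
    case (Suc n)
    then show ?case by (simp add: add scaleR_left_distrib distrib_right)
  qed
  have neg: "L (- y) = - L y" for y
    using add[of y "- y"] add[of 0 0] by simp
  have int: "L (of_int m *\<^sub>R y) = of_int m * L y" for m y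
    using nat[of "nat m" y] nat[of "nat (- m)" y] neg[of "of_nat (nat (- m)) *\<^sub>R y"]
    by (cases "m \<ge> 0") auto
  have rat: "L (t *\<^sub>R x) - t * L x = 0" if "t \<in> \<rat>" for t
  proof -
    from that obtain a b :: int where b: "b \<noteq> 0" and t: "t = of_int a / of_int b"
      by (metis Rats_cases' less_irrefl)
    have "of_int b * L (t *\<^sub>R x) = L (of_int b *\<^sub>R (t *\<^sub>R x))"
      by (rule int[symmetric])
    also have "\<dots> = of_int a * L x"
      using b by (simp add: t int)
    finally show ?thesis using b by (simp add: t field_simps)
  qed
  have c: "continuous_on UNIV (\<lambda>t. L (t *\<^sub>R x) - t * L x)"
    by (intro continuous_intros continuous_on_compose2[OF cont]) auto
  have "L (t *\<^sub>R x) - t * L x = 0"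
    by (rule continuous_constant_on_closure[of \<rat>])
       (use c rat in \<open>auto simp: Rats_closure_real\<close>)
  then show "L (t *\<^sub>R x) = t *\<^sub>R L x" by simp
qed (rule add)

text \<open>The polarisation \<open>b\<close> of \<open>f\<close> satisfies Jensen's midpoint
  equation in its first argument by \<open>diff\<close>, and \<open>b 0 k = 0\<close> turns this
  into additivity. The remainder \<open>l\<close> of \<open>f\<close> after removing the quadratic
  form is linear; since it is also quadratically small at 0, it vanishes.\<close>

lemma third_difference_zero_imp_quadratic:
  fixes f :: "'a::real_normed_vector \<Rightarrow> real"
  assumes cont: "continuous_on UNIV f"
    and bound: "\<And>z. \<bar>f z\<bar> \<le> C * (norm z)\<^sup>2"
    and diff: "\<And>z h k. f (z + h + h + k) - 2 * f (z + h + k) + f (z + k)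
                 = f (z + h + h) - 2 * f (z + h) + f z"
  obtains b where "bilinear b" "\<And>x y. b x y = b y x" "\<And>z. f z = b z z / 2"
proof -
  define b where "b x y = f (x + y) - f x - f y" for x y
  have f0: "f 0 = 0" using bound[of 0] by simp
  have sym: "b x y = b y x" for x y by (simp add: b_def add.commute)
  have mid: "b (z + h + h) k + b z k = 2 * b (z + h) k" for z h k
    using diff[of z h k] by (simp add: b_def)
  have b0: "b 0 k = 0" for k by (simp add: b_def f0)
  have add: "b (x + y) k = b x k + b y k" for x y k
  proof -
    let ?h = "(1/2) *\<^sub>R (y - x)" and ?m = "(1/2) *\<^sub>R (x + y)"
    have "x + ?h = ?m" by (simp add: algebra_simps flip: scaleR_2)
    moreover have "?m + ?h = y" by (simp add: algebra_simps flip: scaleR_left_distrib)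
    moreover have "?m + ?m = x + y" by (simp flip: scaleR_left_distrib)
    ultimately show ?thesis using mid[of x ?h k] mid[of 0 ?m k] b0[of k] by simp
  qed
  have bcont: "continuous_on UNIV (\<lambda>x. b x k)" for k
    unfolding b_def by (intro continuous_intros continuous_on_compose2[OF cont]) auto
  have lin: "linear (\<lambda>x. b x k)" for k
    by (rule additive_continuous_imp_linear[OF add bcont])
  have bil: "bilinear b"
    unfolding bilinear_def using lin sym by (metis (no_types, lifting) ext)
  define l where "l x = f x - b x x / 2" for x
  have ladd: "l (x + y) = l x + l y" for x y
  proof -
    have "b (x + y) (x + y) = b x x + 2 * b x y + b y y"
      using add sym by (smt (verit))
    then show ?thesis by (simp add: l_def b_def[of x y] field_simps)
  qed
  have bcont2: "continuous_on UNIV (\<lambda>x. b x x)"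
    unfolding b_def by (intro continuous_intros continuous_on_compose2[OF cont]) auto
  have "linear l"
    by (rule additive_continuous_imp_linear[OF ladd])
       (unfold l_def, intro continuous_intros cont bcont2, auto)
  have "l x = 0" for x
  proof (rule ccontr)
    assume nz: "l x \<noteq> 0"
    define K where "K = \<bar>C\<bar> * (norm x)\<^sup>2 + \<bar>b x x\<bar>"
    have K0: "K \<ge> 0" by (simp add: K_def)
    have le: "\<bar>l x\<bar> \<le> t * K" if t: "t > 0" for t
    proof -
      have "t * \<bar>l x\<bar> = \<bar>l (t *\<^sub>R x)\<bar>"
        using \<open>linear l\<close> t by (simp add: linear_cmul abs_mult)
      also have "\<dots> = \<bar>f (t *\<^sub>R x) - t\<^sup>2 * b x x / 2\<bar>"
        by (simp add: l_def bilinear_lmul[OF bil] bilinear_rmul[OF bil] power2_eq_square)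
      also have "\<dots> \<le> \<bar>f (t *\<^sub>R x)\<bar> + t\<^sup>2 * \<bar>b x x\<bar>"
        by (rule order_trans[OF abs_triangle_ineq4]) (simp add: abs_mult)
      also have "\<dots> \<le> C * (t\<^sup>2 * (norm x)\<^sup>2) + t\<^sup>2 * \<bar>b x x\<bar>"
        using bound[of "t *\<^sub>R x"] by (simp add: power_mult_distrib)
      also have "\<dots> \<le> \<bar>C\<bar> * (t\<^sup>2 * (norm x)\<^sup>2) + t\<^sup>2 * \<bar>b x x\<bar>"
        by (intro add_right_mono mult_right_mono) auto
      also have "\<dots> = t * (t * K)" by (simp add: K_def power2_eq_square algebra_simps)
      finally show ?thesis using t by simp
    qed
    \<comment> \<open>The scale \<open>t\<close> is chosen so small that the bound falls below half
      of \<open>\<bar>l x\<bar>\<close>.\<close>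
    have "\<bar>l x\<bar> \<le> \<bar>l x\<bar> / (2 * (K + 1)) * K"
      using nz K0 by (intro le) auto
    also have "\<dots> \<le> \<bar>l x\<bar> / 2" using K0 by (simp add: field_simps)
    finally show False using nz by simp
  qed
  then have "f z = b z z / 2" for z by (simp add: l_def)
  with bil sym show ?thesis using that by blast
qed

section \<open>Energy of differences over dyadic scales\<close>

definition mixed_difference :: "('a::real_vector \<Rightarrow> real) \<Rightarrow> 'a \<Rightarrow> 'a \<Rightarrow> 'a \<Rightarrow> real" where
  "mixed_difference g h k x = g (x + h + k) - g (x + h) - g (x + k) + g x"

lemma ball_in_sets_borel [measurable]: "ball (c :: 'a::euclidean_space) r \<in> sets borel"
  by simp

lemma nn_integral_ball_shift_le:
  fixes q :: "'a::euclidean_space \<Rightarrow> ennreal"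
  assumes [measurable]: "q \<in> borel_measurable borel"
  shows "(\<integral>\<^sup>+x. q (x + c) * indicator (ball 0 r) x \<partial>lborel)
       \<le> (\<integral>\<^sup>+x. q x * indicator (ball 0 (r + norm c)) x \<partial>lborel)"
proof -
  have [measurable]: "(\<lambda>x. q x * indicator (ball 0 (r + norm c)) x) \<in> borel_measurable borel"
    by measurable
  have "(\<integral>\<^sup>+x. q (x + c) * indicator (ball 0 r) x \<partial>lborel)
      \<le> (\<integral>\<^sup>+x. q (c + x) * indicator (ball 0 (r + norm c)) (c + x) \<partial>lborel)"
  proof (intro nn_integral_mono)
    fix x :: 'a
    have "norm (c + x) < r + norm c" if "norm x < r"
      using norm_triangle_ineq[of c x] that by linarith
    then show "q (x + c) * indicator (ball 0 r) x
        \<le> q (c + x) * indicator (ball 0 (r + norm c)) (c + x)"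
      by (auto simp: indicator_def add.commute)
  qed
  also have "\<dots> = (\<integral>\<^sup>+x. q x * indicator (ball 0 (r + norm c)) x \<partial>distr lborel borel ((+) c))"
    by (subst nn_integral_distr) auto
  finally show ?thesis by (simp only: lborel_distr_plus)
qed

lemma nn_integral_ball_average_le:
  fixes q :: "'a::euclidean_space \<Rightarrow> real"
  assumes [measurable]: "q \<in> borel_measurable borel" and q0: "\<And>x. 0 \<le> q x"
  shows "(\<integral>\<^sup>+x. ennreal ((q x + q (x + c)) / 2) * indicator (ball 0 r) x \<partial>lborel)
       \<le> (\<integral>\<^sup>+x. ennreal (q x) * indicator (ball 0 (r + norm c)) x \<partial>lborel)" (is "_ \<le> ?I")
proof -
  have "(\<integral>\<^sup>+x. ennreal (q x) * indicator (ball 0 r) x \<partial>lborel) \<le> ?I"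
    by (intro nn_integral_mono mult_left_mono) (auto simp: indicator_def intro: less_le_trans)
  moreover have "(\<integral>\<^sup>+x. ennreal (q (x + c)) * indicator (ball 0 r) x \<partial>lborel) \<le> ?I"
    by (rule nn_integral_ball_shift_le) measurable
  ultimately have le: "(\<integral>\<^sup>+x. ennreal (q x) * indicator (ball 0 r) x \<partial>lborel)
      + (\<integral>\<^sup>+x. ennreal (q (x + c)) * indicator (ball 0 r) x \<partial>lborel) \<le> ?I + ?I"
    by (rule add_mono)
  have sum: "(\<integral>\<^sup>+x. ennreal (q x) * indicator (ball 0 r) x
           + ennreal (q (x + c)) * indicator (ball 0 r) x \<partial>lborel)
      = (\<integral>\<^sup>+x. ennreal (q x) * indicator (ball 0 r) x \<partial>lborel)
      + (\<integral>\<^sup>+x. ennreal (q (x + c)) * indicator (ball 0 r) x \<partial>lborel)"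
    by (rule nn_integral_add) measurable
  have "(\<integral>\<^sup>+x. ennreal ((q x + q (x + c)) / 2) * indicator (ball 0 r) x \<partial>lborel)
      = (\<integral>\<^sup>+x. ennreal (1/2) * (ennreal (q x) * indicator (ball 0 r) x
           + ennreal (q (x + c)) * indicator (ball 0 r) x) \<partial>lborel)"
  proof (intro nn_integral_cong)
    fix x :: 'a
    have "ennreal ((q x + q (x + c)) / 2) = ennreal (1/2 * (q x + q (x + c)))" by simp
    also have "\<dots> = ennreal (1/2) * (ennreal (q x) + ennreal (q (x + c)))"
      using q0 by (subst ennreal_mult) (auto simp: ennreal_plus)
    finally show "ennreal ((q x + q (x + c)) / 2) * indicator (ball 0 r) x
      = ennreal (1/2) * (ennreal (q x) * indicator (ball 0 r) x
           + ennreal (q (x + c)) * indicator (ball 0 r) x)"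
      by (auto simp: indicator_def)
  qed
  also have "\<dots> = ennreal (1/2) * ((\<integral>\<^sup>+x. ennreal (q x) * indicator (ball 0 r) x \<partial>lborel)
      + (\<integral>\<^sup>+x. ennreal (q (x + c)) * indicator (ball 0 r) x \<partial>lborel))"
    by (subst nn_integral_cmult; (measurable)?) (simp only: sum)
  also have "\<dots> \<le> ennreal (1/2) * (?I + ?I)"
    by (intro mult_left_mono le) simp
  also have "\<dots> = (ennreal (1/2) * 2) * ?I"
    by (simp add: mult.assoc mult_2[symmetric])
  also have "ennreal (1/2) * 2 = ennreal (1/2 * 2)"
    by (subst ennreal_mult) auto
  finally show ?thesis by simp
qed

text \<open>A difference quotient for the second derivative of \<open>g\<close> in the directions
  \<open>h\<close> and \<open>k\<close>: both steps carry \<open>1/2^n\<close>, so a bound on mixed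
  differences that is quadratic in the steps becomes uniform in \<open>n\<close>.\<close>

definition scaled_difference ::
    "('a::real_normed_vector \<Rightarrow> real) \<Rightarrow> 'a \<Rightarrow> 'a \<Rightarrow> nat \<Rightarrow> 'a \<Rightarrow> real" where
  "scaled_difference g h k n x = 4 ^ n * mixed_difference g ((1/2^n) *\<^sub>R h) ((1/2^n) *\<^sub>R k) x"

text \<open>Halving both sides cuts the parallelogram spanned by the steps into four. Mixed
  differences add up over such a subdivision, and the factor 4 between the levels turns the sum into
  a mean.\<close>

lemma scaled_difference_average:
  fixes h k :: "'a::real_normed_vector"
  assumes h': "h' = (1/2^Suc n) *\<^sub>R h" and k': "k' = (1/2^Suc n) *\<^sub>R k"
    and p: "p = scaled_difference g h k (Suc n)"
  shows "scaled_difference g h k n x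
       = ((p x + p (x + h')) / 2 + (p (x + k') + p (x + k' + h')) / 2) / 2"
proof -
  have h: "(1/2^n) *\<^sub>R h = h' + h'" and k: "(1/2^n) *\<^sub>R k = k' + k'"
    by (simp_all add: h' k' flip: scaleR_left_distrib)
  have p': "p x = 4 * 4 ^ n * mixed_difference g h' k' x" for x
    by (simp add: p scaled_difference_def h' k')
  show ?thesis
    unfolding p' unfolding scaled_difference_def h k mixed_difference_def
    by (simp add: field_simps add.assoc)
qed

text \<open>With \<open>m\<close> the average of two values of the next level, the identity
  \<open>((a + b) / 2)\<^sup>2 + ((a - b) / 2)\<^sup>2 = (a\<^sup>2 + b\<^sup>2) / 2\<close> shows that the energy of the scaled
  second differences grows, from each dyadic scale to the next, at least by the energy of the
  third differences; being bounded, it makes the latter summable over all scales. The balls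
  grow by the current shift, so that no boundary terms appear.\<close>

lemma energy_bound:
  fixes g :: "'a::euclidean_space \<Rightarrow> real" and h k :: 'a
  assumes cont: "continuous_on UNIV g"
    and bound: "\<And>h k x. \<bar>mixed_difference g h k x\<bar> \<le> C * (norm h + norm k)\<^sup>2"
  defines "\<psi> \<equiv> scaled_difference g h k"
  defines "D \<equiv> \<lambda>n x. \<psi> n (x + (1/2^n) *\<^sub>R h) - \<psi> n x"
  shows "(\<Sum>n. \<integral>\<^sup>+x. ennreal ((D (Suc n) x)\<^sup>2 / 4) * indicator (ball 0 R) x \<partial>lborel) < top"
proof -
  have \<psi>cont: "continuous_on UNIV (\<psi> n)" for n
    unfolding \<psi>_def scaled_difference_def mixed_difference_def
    by (intro continuous_intros continuous_on_compose2[OF cont]) auto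
  have [measurable]: "\<psi> n \<in> borel_measurable borel" for n
    by (rule borel_measurable_continuous_onI[OF \<psi>cont])
  have [measurable]: "D n \<in> borel_measurable borel" for n
    unfolding D_def by measurable
  define H where "H = norm h + norm k"
  define B where "B = C * H\<^sup>2"
  have \<psi>B: "\<bar>\<psi> n x\<bar> \<le> B" for n x
  proof -
    have "\<bar>\<psi> n x\<bar> \<le> 4 ^ n * (C * (norm ((1/2^n) *\<^sub>R h) + norm ((1/2^n) *\<^sub>R k))\<^sup>2)"
      unfolding \<psi>_def scaled_difference_def abs_mult by (intro mult_mono bound) auto
    also have "norm ((1/2^n) *\<^sub>R h) + norm ((1/2^n) *\<^sub>R k) = H / 2 ^ n"
      by (simp add: H_def field_simps)
    also have "4 ^ n * (C * (H / 2 ^ n)\<^sup>2) = B"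
      by (simp add: B_def power_divide power_mult[symmetric] mult.commute[of n])
         (simp add: power_mult)
    finally show ?thesis .
  qed
  \<comment> \<open>The lengths of the shifts \<open>h'\<close> and \<open>k'\<close> over the first
    \<open>n\<close> levels add up to \<open>H * (1 - 1/2^n)\<close>, so the radii never exceed
    \<open>R + H\<close>.\<close>
  define \<rho> where "\<rho> n = R + H * (1 - 1/2^n)" for n
  define E where "E n = (\<integral>\<^sup>+x. ennreal ((\<psi> n x)\<^sup>2) * indicator (ball 0 (\<rho> n)) x \<partial>lborel)" for n
  define I where "I n = (\<integral>\<^sup>+x. ennreal ((D (Suc n) x)\<^sup>2 / 4) * indicator (ball 0 R) x \<partial>lborel)" for n
  have step: "E n + I n \<le> E (Suc n)" for n
  proof -
    define h' where "h' = (1/2^Suc n) *\<^sub>R h"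
    define k' where "k' = (1/2^Suc n) *\<^sub>R k"
    \<comment> \<open>Only the average in direction \<open>h'\<close> is resolved by the identity
      and yields the gain; the average in direction \<open>k'\<close> is estimated by convexity of
      the square.\<close>
    define m where "m x = (\<psi> (Suc n) x + \<psi> (Suc n) (x + h')) / 2" for x
    define r where "r = \<rho> n + norm k'"
    have [measurable]: "m \<in> borel_measurable borel" unfolding m_def by measurable
    have "0 \<le> H * (1 - 1/2^n)"
      by (intro mult_nonneg_nonneg) (auto simp: H_def)
    then have Rr: "R \<le> r" by (simp add: r_def \<rho>_def)
    have rr: "r + norm h' = \<rho> (Suc n)"
      by (simp add: r_def \<rho>_def h'_def k'_def H_def field_simps)
    have "E n \<le> (\<integral>\<^sup>+x. ennreal (((m x)\<^sup>2 + (m (x + k'))\<^sup>2) / 2) * indicator (ball 0 (\<rho> n)) x \<partial>lborel)"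
      unfolding E_def
    proof (intro nn_integral_mono mult_right_mono ennreal_leI)
      fix x
      have "\<psi> n x = (m x + m (x + k')) / 2"
        unfolding \<psi>_def m_def by (rule scaled_difference_average[OF h'_def k'_def refl])
      then have "(\<psi> n x)\<^sup>2 = ((m x)\<^sup>2 + (m (x + k'))\<^sup>2 + 2 * m x * m (x + k')) / 4"
        by (simp only: power2_eq_square) (simp add: algebra_simps)
      then show "(\<psi> n x)\<^sup>2 \<le> ((m x)\<^sup>2 + (m (x + k'))\<^sup>2) / 2"
        using sum_squares_bound[of "m x" "m (x + k')"] by simp
    qed simp
    also have "\<dots> \<le> (\<integral>\<^sup>+x. ennreal ((m x)\<^sup>2) * indicator (ball 0 r) x \<partial>lborel)"
      unfolding r_def by (rule nn_integral_ball_average_le) auto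
    finally have 1: "E n \<le> (\<integral>\<^sup>+x. ennreal ((m x)\<^sup>2) * indicator (ball 0 r) x \<partial>lborel)" .
    have 2: "I n \<le> (\<integral>\<^sup>+x. ennreal ((D (Suc n) x)\<^sup>2 / 4) * indicator (ball 0 r) x \<partial>lborel)"
      unfolding I_def using Rr
      by (intro nn_integral_mono mult_left_mono) (auto simp: indicator_def)
    have "E n + I n \<le> (\<integral>\<^sup>+x. ennreal ((m x)\<^sup>2) * indicator (ball 0 r) x \<partial>lborel)
        + (\<integral>\<^sup>+x. ennreal ((D (Suc n) x)\<^sup>2 / 4) * indicator (ball 0 r) x \<partial>lborel)"
      by (rule add_mono[OF 1 2])
    also have "\<dots> = (\<integral>\<^sup>+x. ennreal ((m x)\<^sup>2) * indicator (ball 0 r) x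
        + ennreal ((D (Suc n) x)\<^sup>2 / 4) * indicator (ball 0 r) x \<partial>lborel)"
      by (rule nn_integral_add[symmetric]) measurable
    also have "\<dots> = (\<integral>\<^sup>+x. ennreal (((\<psi> (Suc n) x)\<^sup>2 + (\<psi> (Suc n) (x + h'))\<^sup>2) / 2)
        * indicator (ball 0 r) x \<partial>lborel)"
    proof (intro nn_integral_cong)
      fix x
      have eq: "(m x)\<^sup>2 + (D (Suc n) x)\<^sup>2 / 4 = ((\<psi> (Suc n) x)\<^sup>2 + (\<psi> (Suc n) (x + h'))\<^sup>2) / 2"
        unfolding m_def D_def h'_def[symmetric] by (simp add: power2_eq_square field_simps)
      show "ennreal ((m x)\<^sup>2) * indicator (ball 0 r) x
          + ennreal ((D (Suc n) x)\<^sup>2 / 4) * indicator (ball 0 r) x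
        = ennreal (((\<psi> (Suc n) x)\<^sup>2 + (\<psi> (Suc n) (x + h'))\<^sup>2) / 2) * indicator (ball 0 r) x"
        unfolding eq[symmetric]
        by (simp add: distrib_right[symmetric] ennreal_plus[symmetric] del: ennreal_plus)
    qed
    also have "\<dots> \<le> (\<integral>\<^sup>+x. ennreal ((\<psi> (Suc n) x)\<^sup>2) * indicator (ball 0 (r + norm h')) x \<partial>lborel)"
      by (rule nn_integral_ball_average_le) auto
    finally show ?thesis by (simp add: E_def rr)
  qed
  have "(\<Sum>i<n. I i) \<le> E n" for n
  proof (induction n)
    case (Suc n)
    have "(\<Sum>i<Suc n. I i) \<le> E n + I n" using Suc by (simp add: add_right_mono)
    also have "\<dots> \<le> E (Suc n)" by (rule step)
    finally show ?case .
  qed simp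
  moreover have "E n \<le> ennreal (B\<^sup>2) * emeasure lborel (ball (0::'a) (R + H))" for n
  proof -
    have "E n \<le> (\<integral>\<^sup>+x. ennreal (B\<^sup>2) * indicator (ball 0 (R + H)) (x::'a) \<partial>lborel)"
      unfolding E_def
    proof (intro nn_integral_mono mult_mono ennreal_leI)
      fix x :: 'a
      show "(\<psi> n x)\<^sup>2 \<le> B\<^sup>2" using \<psi>B[of n x] by (metis abs_ge_zero power2_abs power_mono)
      have "H * (1 - 1/2^n) \<le> H"
        by (rule mult_left_le) (auto simp: H_def)
      then show "indicator (ball 0 (\<rho> n)) x \<le> (indicator (ball 0 (R + H)) x :: ennreal)"
        by (auto simp: indicator_def \<rho>_def)
    qed auto
    then show ?thesis by (simp add: nn_integral_cmult_indicator)
  qed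
  ultimately have "(\<Sum>i<n. I i) \<le> ennreal (B\<^sup>2) * emeasure lborel (ball (0::'a) (R + H))" for n
    using order_trans by blast
  then have "(\<Sum>i. I i) \<le> ennreal (B\<^sup>2) * emeasure lborel (ball (0::'a) (R + H))"
    by (intro suminf_le_const) auto
  also have "\<dots> < top"
    using emeasure_lborel_ball_finite[of "0::'a" "R + H"] by (simp add: ennreal_mult_less_top)
  finally show ?thesis by (simp add: I_def)
qed

text \<open>Summable energy gives, by exchanging sum and integral, an almost everywhere convergent
  series, whose terms tend to 0. The moving base point \<open>x + (1/2^n) *\<^sub>R z\<close> is
  what a blow-up at \<open>x\<close> evaluates at \<open>z\<close>; it is absorbed by enlarging the
  ball by \<open>norm z\<close>.\<close>

lemma AE_scaled_third_difference_tendsto_0: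
  fixes g :: "'a::euclidean_space \<Rightarrow> real" and h k z :: 'a
  assumes cont: "continuous_on UNIV g"
    and bound: "\<And>h k x. \<bar>mixed_difference g h k x\<bar> \<le> C * (norm h + norm k)\<^sup>2"
  shows "AE x in lborel. (\<lambda>n. scaled_difference g h k n (x + (1/2^n) *\<^sub>R z + (1/2^n) *\<^sub>R h)
            - scaled_difference g h k n (x + (1/2^n) *\<^sub>R z)) \<longlonglongrightarrow> 0"
proof -
  define \<psi> where "\<psi> = scaled_difference g h k"
  define D where "D n x = \<psi> n (x + (1/2^n) *\<^sub>R h) - \<psi> n x" for n x
  have \<psi>cont: "continuous_on UNIV (\<psi> n)" for n
    unfolding \<psi>_def scaled_difference_def mixed_difference_def
    by (intro continuous_intros continuous_on_compose2[OF cont]) auto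
  have [measurable]: "\<psi> n \<in> borel_measurable borel" for n
    by (rule borel_measurable_continuous_onI[OF \<psi>cont])
  have [measurable]: "D n \<in> borel_measurable borel" for n
    unfolding D_def by measurable
  \<comment> \<open>The energy estimate starts at level 1, hence \<open>Suc n\<close>; the index
    shift is undone by \<open>LIMSEQ_imp_Suc\<close>.\<close>
  define c where "c n = (1/2^Suc n) *\<^sub>R z" for n
  have "AE x in lborel. x \<in> ball 0 (real R) \<longrightarrow> (\<lambda>n. D n (x + (1/2^n) *\<^sub>R z)) \<longlonglongrightarrow> 0" for R
  proof -
    let ?F = "\<lambda>n x. ennreal ((D (Suc n) (x + c n))\<^sup>2 / 4) * indicator (ball 0 (real R)) x"
    have "(\<integral>\<^sup>+x. (\<Sum>n. ?F n x) \<partial>lborel) = (\<Sum>n. \<integral>\<^sup>+x. ?F n x \<partial>lborel)"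
      by (rule nn_integral_suminf) measurable
    also have "\<dots> \<le> (\<Sum>n. \<integral>\<^sup>+x. ennreal ((D (Suc n) x)\<^sup>2 / 4)
        * indicator (ball 0 (real R + norm z)) x \<partial>lborel)"
    proof (intro suminf_le allI)
      fix n
      have "(\<integral>\<^sup>+x. ?F n x \<partial>lborel) \<le> (\<integral>\<^sup>+x. ennreal ((D (Suc n) x)\<^sup>2 / 4)
        * indicator (ball 0 (real R + norm (c n))) x \<partial>lborel)"
        by (rule nn_integral_ball_shift_le) measurable
      also have "\<dots> \<le> (\<integral>\<^sup>+x. ennreal ((D (Suc n) x)\<^sup>2 / 4)
        * indicator (ball 0 (real R + norm z)) x \<partial>lborel)"
      proof (intro nn_integral_mono mult_left_mono)
        fix x :: 'a
        have "norm (c n) \<le> norm z"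
          using mult_left_mono[OF one_le_power[of "2::real" "Suc n"], of "norm z"]
          by (simp add: c_def divide_le_eq del: power_Suc)
        then show "indicator (ball 0 (real R + norm (c n))) x
            \<le> (indicator (ball 0 (real R + norm z)) x :: ennreal)"
          by (auto simp: indicator_def)
      qed auto
      finally show "(\<integral>\<^sup>+x. ?F n x \<partial>lborel) \<le> \<dots>" .
    qed auto
    also have "\<dots> < top"
      unfolding D_def \<psi>_def by (rule energy_bound[OF cont bound])
    finally have "(\<integral>\<^sup>+x. (\<Sum>n. ?F n x) \<partial>lborel) \<noteq> \<infinity>" by simp
    then have "AE x in lborel. (\<Sum>n. ?F n x) \<noteq> \<infinity>"
      by (rule nn_integral_noteq_infinite[rotated]) measurable
    then show ?thesis
    proof eventually_elim
      case (elim x)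
      show ?case
      proof
        assume "x \<in> ball 0 (real R)"
        then have "(\<Sum>n. ennreal ((D (Suc n) (x + c n))\<^sup>2 / 4)) \<noteq> top"
          using elim by simp
        then have "summable (\<lambda>n. (D (Suc n) (x + c n))\<^sup>2 / 4)"
          by (intro summable_suminf_not_top) auto
        then have "(\<lambda>n. 4 * ((D (Suc n) (x + c n))\<^sup>2 / 4)) \<longlonglongrightarrow> 4 * 0"
          by (intro tendsto_mult_left summable_LIMSEQ_zero)
        then have "(\<lambda>n. sqrt ((D (Suc n) (x + c n))\<^sup>2)) \<longlonglongrightarrow> sqrt 0"
          by (intro tendsto_real_sqrt) simp
        then have "(\<lambda>n. D (Suc n) (x + c n)) \<longlonglongrightarrow> 0"
          by (simp add: tendsto_rabs_zero_iff)
        then have "(\<lambda>n. D (Suc n) (x + (1/2^Suc n) *\<^sub>R z)) \<longlonglongrightarrow> 0" unfolding c_def .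
        then show "(\<lambda>n. D n (x + (1/2^n) *\<^sub>R z)) \<longlonglongrightarrow> 0"
          by (rule LIMSEQ_imp_Suc)
      qed
    qed
  qed
  then have "AE x in lborel. \<forall>R. x \<in> ball 0 (real R) \<longrightarrow> (\<lambda>n. D n (x + (1/2^n) *\<^sub>R z)) \<longlonglongrightarrow> 0"
    unfolding AE_all_countable by blast
  then show ?thesis
  proof eventually_elim
    case (elim x)
    obtain R :: nat where "norm x < real R" using reals_Archimedean2 by blast
    then show ?case using elim[rule_format, of R] by (simp add: D_def \<psi>_def)
  qed
qed

section \<open>Almost everywhere quadratic approximation at some scale\<close>

text \<open>Prolong the segment from \<open>x\<close> to \<open>y\<close> by unit length to
  \<open>w\<close>, still in the ball of radius 2. By convexity the increment up to \<open>y\<close>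
  is at most the fraction \<open>t\<close> of the increment up to \<open>w\<close>, and
  \<open>t\<close> is at most the distance of \<open>x\<close> and \<open>y\<close>.\<close>

lemma convex_bounded_imp_Lipschitz:
  fixes \<phi> :: "'a::real_normed_vector \<Rightarrow> real"
  assumes conv: "convex_on UNIV \<phi>"
    and bound: "\<And>z. norm z \<le> 2 \<Longrightarrow> \<bar>\<phi> z\<bar> \<le> M"
    and "norm x \<le> 1" "norm y \<le> 1"
  shows "\<bar>\<phi> x - \<phi> y\<bar> \<le> 2 * M * norm (x - y)"
proof -
  have le: "\<phi> y - \<phi> x \<le> 2 * M * norm (x - y)" if "norm x \<le> 1" "norm y \<le> 1" for x y
  proof (cases "x = y")
    case False
    define d where "d = norm (y - x)"
    have d: "d > 0" using False by (simp add: d_def)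
    define w where "w = y + (1/d) *\<^sub>R (y - x)"
    define t where "t = d / (1 + d)"
    have t: "0 \<le> t" "t \<le> 1" "t \<le> d" using d by (auto simp: t_def field_simps)
    have "norm w \<le> norm y + norm ((1/d) *\<^sub>R (y - x))"
      unfolding w_def by (rule norm_triangle_ineq)
    then have w2: "norm w \<le> 2" using that d by (simp add: d_def)
    have "(1 + d) *\<^sub>R ((1 - t) *\<^sub>R x + t *\<^sub>R w) = (1 + d) *\<^sub>R y"
      using d unfolding w_def t_def by (simp add: scaleR_add_right scaleR_diff_right divide_simps)
        (simp add: algebra_simps)
    then have y: "(1 - t) *\<^sub>R x + t *\<^sub>R w = y" using d by simp
    have "\<phi> y \<le> (1 - t) * \<phi> x + t * \<phi> w"
      using convex_onD[OF conv t(1,2), of x w] y by simp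
    then have "\<phi> y - \<phi> x \<le> t * (\<phi> w - \<phi> x)" by (simp add: algebra_simps)
    also have "\<dots> \<le> t * (2 * M)"
      using bound[OF w2] bound[of x] that t by (intro mult_left_mono) auto
    also have "\<dots> \<le> d * (2 * M)"
      using bound[of x] that t by (intro mult_right_mono) auto
    finally show ?thesis by (simp add: d_def norm_minus_commute mult.commute)
  qed simp
  show ?thesis using le[OF assms(3,4)] le[OF assms(4,3)] by (simp add: norm_minus_commute abs_le_iff)
qed

section \<open>Semiconcavity and second differences\<close>

lemma continuous_on_semiconcave:
  fixes g :: "'a::euclidean_space \<Rightarrow> real"
  assumes "convex_on UNIV (\<lambda>x. a / 2 * (norm x)\<^sup>2 - g x)"
  shows "continuous_on UNIV g"
proof -
  have "continuous_on UNIV (\<lambda>x. a / 2 * (norm x)\<^sup>2 - (a / 2 * (norm x)\<^sup>2 - g x))"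
    by (intro continuous_intros convex_on_continuous assms) auto
  then show ?thesis by simp
qed

lemma semiconcave_imp_second_difference_le:
  fixes g :: "'a::real_inner \<Rightarrow> real"
  assumes "convex_on UNIV (\<lambda>x. a / 2 * (norm x)\<^sup>2 - g x)"
  shows "g (x + h) + g (x - h) \<le> 2 * g x + a * (norm h)\<^sup>2"
proof -
  have eq: "(1 - 1/2) *\<^sub>R (x + h) + (1/2) *\<^sub>R (x - h) = x"
    by (simp add: algebra_simps flip: scaleR_left_distrib)
  have "a / 2 * (norm x)\<^sup>2 - g x
      \<le> (1 - 1/2) * (a / 2 * (norm (x + h))\<^sup>2 - g (x + h)) + 1/2 * (a / 2 * (norm (x - h))\<^sup>2 - g (x - h))"
    using convex_onD[OF assms, of "1/2" "x + h" "x - h"] unfolding eq by simp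
  moreover have "(norm (x + h))\<^sup>2 + (norm (x - h))\<^sup>2 = 2 * (norm x)\<^sup>2 + 2 * (norm h)\<^sup>2"
    by (simp add: power2_norm_eq_inner algebra_simps)
  then have "a / 2 * ((norm (x + h))\<^sup>2 + (norm (x - h))\<^sup>2) = a * (norm x)\<^sup>2 + a * (norm h)\<^sup>2"
    by (simp add: algebra_simps)
  ultimately show ?thesis by (simp add: algebra_simps)
qed

text \<open>Polarisation: the mixed difference is a difference of two pure second differences
  centred at \<open>x + s\<close>, along the half diagonals \<open>s\<close> and \<open>d\<close> of
  the parallelogram.\<close>

lemma mixed_difference_bound:
  fixes g :: "'a::real_inner \<Rightarrow> real"
  assumes up: "\<And>x h. g (x + h) + g (x - h) \<le> 2 * g x + a * (norm h)\<^sup>2"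
    and low: "\<And>x h. 2 * g x \<le> g (x + h) + g (x - h) + a * (norm h)\<^sup>2"
    and "0 \<le> a"
  shows "\<bar>mixed_difference g h k x\<bar> \<le> a * (norm h + norm k)\<^sup>2"
proof -
  define s where "s = (1/2) *\<^sub>R (h + k)"
  define d where "d = (1/2) *\<^sub>R (h - k)"
  have e: "s + s = h + k" "d + d = h - k" by (simp_all add: s_def d_def flip: scaleR_left_distrib)
  have sd: "s + d = h" "s - d = k"
    by (simp_all add: s_def d_def algebra_simps flip: scaleR_left_distrib)
  have "mixed_difference g h k x
      = (g (x + s + s) + g (x + s - s) - 2 * g (x + s)) - (g (x + s + d) + g (x + s - d) - 2 * g (x + s))"
    using e sd by (simp add: mixed_difference_def add.assoc add_diff_eq[symmetric])
  also have "\<bar>\<dots>\<bar> \<le> a * (norm s)\<^sup>2 + a * (norm d)\<^sup>2"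
    using up[of "x + s" s] low[of "x + s" s] up[of "x + s" d] low[of "x + s" d] by linarith
  also have "\<dots> = a * ((norm s)\<^sup>2 + (norm d)\<^sup>2)" by (simp add: distrib_left)
  also have "(norm s)\<^sup>2 + (norm d)\<^sup>2 = ((norm h)\<^sup>2 + (norm k)\<^sup>2) / 2"
    unfolding sd[symmetric] by (simp add: power2_norm_eq_inner algebra_simps)
  also have "a * \<dots> \<le> a * (norm h + norm k)\<^sup>2"
    using \<open>0 \<le> a\<close> by (intro mult_left_mono) (auto simp: power2_sum)
  finally show ?thesis .
qed

lemma compact_function_box:
  fixes B :: "'a \<Rightarrow> real"
  shows "compact {w. \<forall>z. \<bar>w z\<bar> \<le> B z}"
proof -
  have "compactin (product_topology (\<lambda>i. euclidean) UNIV) (PiE UNIV (\<lambda>z. {- B z..B z}))"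
    by (subst compactin_PiE) (auto simp: compactin_euclidean_iff)
  moreover have "PiE UNIV (\<lambda>z. {- B z..B z}) = {w. \<forall>z. \<bar>w z\<bar> \<le> B z}"
    by (auto simp: abs_le_iff PiE_iff) (metis minus_le_iff)+
  ultimately show ?thesis
    by (simp add: euclidean_product_topology compactin_euclidean_iff)
qed

text \<open>A substitute for Alexandrov's theorem: the blow-ups of \<open>g\<close> at almost every point have a
  pointwise cluster point (Tychonoff), whose third differences vanish, hence which is a
  quadratic form.\<close>

lemma AE_quadratic_at_some_scale:
  fixes g :: "'a::euclidean_space \<Rightarrow> real"
  assumes conv: "convex_on UNIV (\<lambda>x. a / 2 * (norm x)\<^sup>2 - g x)"
    and semi: "\<And>x h. 2 * g x \<le> g (x + h) + g (x - h) + a * (norm h)\<^sup>2"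
    and "0 \<le> a"
  shows "AE x in lborel. \<forall>q \<delta> r0.
    (\<forall>y. \<bar>g y - g x - q \<bullet> (y - x)\<bar> \<le> C * (norm (y - x))\<^sup>2) \<longrightarrow> 0 < \<delta> \<longrightarrow> 0 < r0 \<longrightarrow>
    (\<exists>r b. 0 < r \<and> r < r0 \<and> bilinear b \<and> (\<forall>y z. b y z = b z y) \<and>
       (\<forall>y. norm (y - x) \<le> r \<longrightarrow> \<bar>g y - g x - q \<bullet> (y - x) - b (y - x) (y - x) / 2\<bar> \<le> \<delta> * r\<^sup>2))"
proof -
  have gcont: "continuous_on UNIV g" by (rule continuous_on_semiconcave[OF conv])
  have mixed: "\<bar>mixed_difference g h k x\<bar> \<le> a * (norm h + norm k)\<^sup>2" for h k x
    by (rule mixed_difference_bound[OF semiconcave_imp_second_difference_le[OF conv] semi \<open>0 \<le> a\<close>])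
  \<comment> \<open>The exceptional null set depends on \<open>z\<close>, \<open>h\<close> and
    \<open>k\<close>, so they are restricted to a countable dense set; continuity of the limit
    removes the restriction later.\<close>
  obtain D :: "'a set" where D: "countable D" "\<And>X. open X \<Longrightarrow> X \<noteq> {} \<Longrightarrow> \<exists>d\<in>D. d \<in> X"
    by (rule countable_dense_setE) blast
  have Dcl: "closure D = UNIV"
    using D(2) by (auto simp: closure_iff_nhds_not_empty) (metis disjoint_iff empty_iff in_mono)
  have "AE x in lborel. \<forall>z\<in>D. \<forall>h\<in>D. \<forall>k\<in>D.
      (\<lambda>n. scaled_difference g h k n (x + (1/2^n) *\<^sub>R z + (1/2^n) *\<^sub>R h)
            - scaled_difference g h k n (x + (1/2^n) *\<^sub>R z)) \<longlonglongrightarrow> 0"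
    using D(1) by (intro AE_ball_countable' AE_scaled_third_difference_tendsto_0[OF gcont mixed])
  then show ?thesis
  proof eventually_elim
    case (elim x)
    show ?case
    proof (intro allI impI)
      fix q :: 'a and \<delta> r0 :: real
      assume taylor: "\<forall>y. \<bar>g y - g x - q \<bullet> (y - x)\<bar> \<le> C * (norm (y - x))\<^sup>2"
        and \<delta>: "0 < \<delta>" and r0: "0 < r0"
      \<comment> \<open>The blow-ups of \<open>g\<close> at \<open>x\<close>, with the affine part
        subtracted and the scaling that preserves quadratic forms.\<close>
      define w where "w n z = 4^n * (g (x + (1/2^n) *\<^sub>R z) - g x - q \<bullet> ((1/2^n) *\<^sub>R z))" for n z
      have w_bound: "\<bar>w n z\<bar> \<le> C * (norm z)\<^sup>2" for n z
      proof -
        have "\<bar>w n z\<bar> \<le> 4^n * (C * (norm ((1/2^n) *\<^sub>R z))\<^sup>2)"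
          using taylor[rule_format, of "x + (1/2^n) *\<^sub>R z"] by (simp add: w_def abs_mult)
        also have "\<dots> = C * (norm z)\<^sup>2"
          by (simp add: power_divide power_mult[symmetric] mult.commute[of n]) (simp add: power_mult)
        finally show ?thesis .
      qed
      have w_conv: "convex_on UNIV (\<lambda>z. a / 2 * (norm z)\<^sup>2 - w n z)" for n
      proof (rule convex_onI)
        fix t :: real and y z :: 'a
        assume t: "0 < t" "t < 1"
        define \<Phi> where "\<Phi> x = a / 2 * (norm x)\<^sup>2 - g x" for x
        define s :: real where "s = 1/2^n"
        define A where "A = 4^n * (g x - a / 2 * (norm x)\<^sup>2)"
        define v where "v = (4^n * s) *\<^sub>R (q - a *\<^sub>R x)"
        define L where "L z = A + v \<bullet> z" for z
        have s4: "4^n * s\<^sup>2 = 1"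
          by (simp add: s_def power_divide power_mult[symmetric] mult.commute[of n]) (simp add: power_mult)
        \<comment> \<open>Up to an affine function the expression is a rescaling of the convex
          \<open>\<Phi>\<close>, so the blow-ups keep the semiconcavity constant
          \<open>a\<close>.\<close>
        have rep: "a / 2 * (norm z)\<^sup>2 - w n z = 4^n * \<Phi> (x + s *\<^sub>R z) + L z" for z
        proof -
          have "(norm (x + s *\<^sub>R z))\<^sup>2 = (norm x)\<^sup>2 + 2 * s * (x \<bullet> z) + s\<^sup>2 * (norm z)\<^sup>2"
            unfolding power2_norm_eq_inner
            by (simp add: algebra_simps inner_commute[of z x] power2_eq_square)
          then have "4^n * (a / 2 * (norm (x + s *\<^sub>R z))\<^sup>2)
              = 4^n * (a / 2 * (norm x)\<^sup>2 + a * s * (x \<bullet> z)) + (4^n * s\<^sup>2) * (a / 2 * (norm z)\<^sup>2)"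
            by (simp add: algebra_simps)
          then show ?thesis unfolding w_def L_def A_def v_def \<Phi>_def s_def[symmetric] s4
            by (simp add: algebra_simps)
        qed
        have arg: "x + s *\<^sub>R ((1 - t) *\<^sub>R y + t *\<^sub>R z)
            = (1 - t) *\<^sub>R (x + s *\<^sub>R y) + t *\<^sub>R (x + s *\<^sub>R z)"
          by (simp add: algebra_simps)
        have "\<Phi> (x + s *\<^sub>R ((1 - t) *\<^sub>R y + t *\<^sub>R z))
            \<le> (1 - t) * \<Phi> (x + s *\<^sub>R y) + t * \<Phi> (x + s *\<^sub>R z)"
          unfolding arg using convex_onD[OF conv] t by (simp add: \<Phi>_def)
        then have "4^n * \<Phi> (x + s *\<^sub>R ((1 - t) *\<^sub>R y + t *\<^sub>R z))
            \<le> 4^n * ((1 - t) * \<Phi> (x + s *\<^sub>R y) + t * \<Phi> (x + s *\<^sub>R z))"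
          by (intro mult_left_mono) auto
        moreover have "L ((1 - t) *\<^sub>R y + t *\<^sub>R z) = (1 - t) * L y + t * L z"
          by (simp add: L_def inner_add_right) (simp add: algebra_simps)
        ultimately show "a / 2 * (norm ((1 - t) *\<^sub>R y + t *\<^sub>R z))\<^sup>2 - w n ((1 - t) *\<^sub>R y + t *\<^sub>R z)
            \<le> (1 - t) * (a / 2 * (norm y)\<^sup>2 - w n y) + t * (a / 2 * (norm z)\<^sup>2 - w n z)"
          unfolding rep by (simp add: algebra_simps)
      qed simp
      define T where "T u z h k = mixed_difference u h k (z + h) - mixed_difference u h k z"
        for u :: "'a \<Rightarrow> real" and z h k
      have T_w: "(\<lambda>n. T (w n) z h k) \<longlonglongrightarrow> 0" if "z \<in> D" "h \<in> D" "k \<in> D" for z h k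
      proof -
        \<comment> \<open>Mixed differences annihilate affine functions, so only the rescaled
          differences of \<open>g\<close> remain.\<close>
        have m: "mixed_difference (w n) h k z = scaled_difference g h k n (x + (1/2^n) *\<^sub>R z)" for n z
          by (simp add: mixed_difference_def scaled_difference_def w_def algebra_simps)
        have arg: "x + (1/2^n) *\<^sub>R (z + h) = x + (1/2^n) *\<^sub>R z + (1/2^n) *\<^sub>R h" for n
          by (simp add: algebra_simps)
        show ?thesis unfolding T_def m arg using elim that by blast
      qed
      \<comment> \<open>Compactness for pointwise convergence yields a cluster point, not a
        convergent subsequence. The argument therefore runs along \<open>G\<close>, a filter finer
        than \<open>F\<close> that converges to \<open>f\<close>.\<close>
      define F where "F = filtermap w sequentially"
      have Fbot: "F \<noteq> bot" by (simp add: F_def filtermap_bot_iff)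
      have "eventually (\<lambda>u. u \<in> {u. \<forall>z. \<bar>u z\<bar> \<le> C * (norm z)\<^sup>2}) F"
        using w_bound by (simp add: F_def eventually_filtermap)
      then obtain f where f_bound: "\<And>z. \<bar>f z\<bar> \<le> C * (norm z)\<^sup>2" and Gbot: "inf (nhds f) F \<noteq> bot"
        using compact_function_box[of "\<lambda>z. C * (norm z)\<^sup>2", unfolded compact_filter] Fbot by blast
      define G where "G = inf (nhds f) F"
      have G: "G \<noteq> bot" "G \<le> F" "G \<le> nhds f" using Gbot by (auto simp: G_def)
      have ev: "((\<lambda>u. u z) \<longlongrightarrow> f z) G" for z
      proof (rule tendsto_mono[OF G(3)], rule topological_tendstoI)
        fix S assume "open S" "f z \<in> S"
        moreover from \<open>open S\<close> have "open ((\<lambda>u. u z) -` S)"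
          using continuous_on_product_coordinates by (rule open_vimage)
        ultimately show "\<forall>\<^sub>F u in nhds f. u z \<in> S"
          unfolding eventually_nhds by (intro exI[of _ "(\<lambda>u. u z) -` S"]) auto
      qed
      have f_conv: "convex_on UNIV (\<lambda>z. a / 2 * (norm z)\<^sup>2 - f z)"
      proof (rule convex_onI)
        fix t :: real and y z :: 'a
        assume t: "0 < t" "t < 1"
        show "a / 2 * (norm ((1 - t) *\<^sub>R y + t *\<^sub>R z))\<^sup>2 - f ((1 - t) *\<^sub>R y + t *\<^sub>R z)
            \<le> (1 - t) * (a / 2 * (norm y)\<^sup>2 - f y) + t * (a / 2 * (norm z)\<^sup>2 - f z)"
        proof (rule tendsto_le[OF G(1)])
          show "\<forall>\<^sub>F u in G. a / 2 * (norm ((1 - t) *\<^sub>R y + t *\<^sub>R z))\<^sup>2 - u ((1 - t) *\<^sub>R y + t *\<^sub>R z)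
            \<le> (1 - t) * (a / 2 * (norm y)\<^sup>2 - u y) + t * (a / 2 * (norm z)\<^sup>2 - u z)"
            by (rule filter_leD[OF G(2)])
               (use convex_onD[OF w_conv] t in \<open>simp add: F_def eventually_filtermap\<close>)
        qed (intro tendsto_intros ev)+
      qed simp
      have f_cont: "continuous_on UNIV f" by (rule continuous_on_semiconcave[OF f_conv])
      have T_f_D: "T f z h k = 0" if "z \<in> D" "h \<in> D" "k \<in> D" for z h k
      proof (rule tendsto_unique[OF G(1)])
        show "((\<lambda>u. T u z h k) \<longlongrightarrow> T f z h k) G"
          unfolding T_def mixed_difference_def by (intro tendsto_intros ev)
        have "((\<lambda>u. T u z h k) \<longlongrightarrow> 0) F"
          using T_w[OF that] by (simp add: F_def filterlim_filtermap)
        then show "((\<lambda>u. T u z h k) \<longlongrightarrow> 0) G" by (rule tendsto_mono[OF G(2)])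
      qed
      have T_f: "T f z h k = 0" for z h k
      proof -
        have "(\<lambda>(z, h, k). T f z h k) (z, h, k) = 0"
        proof (rule continuous_constant_on_closure[where S = "D \<times> D \<times> D"])
          show "continuous_on (closure (D \<times> D \<times> D)) (\<lambda>(z, h, k). T f z h k)"
            unfolding T_def mixed_difference_def case_prod_beta
            by (intro continuous_intros continuous_on_compose2[OF f_cont]) auto
        qed (use T_f_D in \<open>auto simp: closure_Times Dcl\<close>)
        then show ?thesis by simp
      qed
      have diff: "f (z + h + h + k) - 2 * f (z + h + k) + f (z + k) = f (z + h + h) - 2 * f (z + h) + f z"
        for z h k
        using T_f[of z h k] by (simp add: T_def mixed_difference_def)
      obtain b where b: "bilinear b" "\<And>x y. b x y = b y x" "\<And>z. f z = b z z / 2"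
        using third_difference_zero_imp_quadratic[OF f_cont f_bound diff] by blast
      define M where "M = 2 * a + 4 * \<bar>C\<bar>"
      have M0: "M \<ge> 0" using \<open>0 \<le> a\<close> by (simp add: M_def)
      \<comment> \<open>This common Lipschitz bound upgrades pointwise closeness on a finite net to
        uniform closeness on the unit ball; the quadratic term cancels when two such functions are
        compared.\<close>
      have lip: "\<bar>(a / 2 * (norm y)\<^sup>2 - u y) - (a / 2 * (norm z)\<^sup>2 - u z)\<bar> \<le> 2 * M * norm (y - z)"
        if "convex_on UNIV (\<lambda>z. a / 2 * (norm z)\<^sup>2 - u z)" "\<And>z. \<bar>u z\<bar> \<le> C * (norm z)\<^sup>2"
          "norm y \<le> 1" "norm z \<le> 1" for u :: "'a \<Rightarrow> real" and y z
      proof (rule convex_bounded_imp_Lipschitz[OF that(1) _ that(3,4)])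
        fix z :: 'a assume "norm z \<le> 2"
        then have z4: "(norm z)\<^sup>2 \<le> 4" using power_mono[of "norm z" 2 2] by simp
        have "\<bar>a / 2 * (norm z)\<^sup>2 - u z\<bar> \<le> \<bar>a / 2 * (norm z)\<^sup>2\<bar> + \<bar>u z\<bar>" by simp
        also have "\<dots> \<le> a / 2 * (norm z)\<^sup>2 + \<bar>C\<bar> * (norm z)\<^sup>2"
          using that(2)[of z] \<open>0 \<le> a\<close> mult_right_mono[OF abs_ge_self[of C], of "(norm z)\<^sup>2"] by simp
        also have "\<dots> \<le> a / 2 * 4 + \<bar>C\<bar> * 4"
          using z4 \<open>0 \<le> a\<close> by (intro add_mono mult_left_mono) auto
        finally show "\<bar>a / 2 * (norm z)\<^sup>2 - u z\<bar> \<le> M" by (simp add: M_def)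
      qed
      \<comment> \<open>Makes each of the two Lipschitz errors at most \<open>\<delta> / 4\<close>;
        the error at the net point accounts for the other \<open>\<delta> / 2\<close>.\<close>
      define \<kappa> where "\<kappa> = \<delta> / (8 * (M + 1))"
      have \<kappa>: "\<kappa> > 0" using \<delta> M0 by (simp add: \<kappa>_def)
      have cover: "cball (0::'a) 1 \<subseteq> (\<Union>y\<in>cball 0 1. ball y \<kappa>)" using \<kappa> by auto
      obtain Y where Y: "Y \<subseteq> cball 0 1" "finite Y" "cball 0 1 \<subseteq> (\<Union>y\<in>Y. ball (y::'a) \<kappa>)"
        by (rule compactE_image[OF compact_cball _ cover]) auto
      obtain N where N: "1 / 2 ^ N < r0"
        using real_arch_pow_inv[of r0 "1/2"] r0 by (auto simp: power_one_over)
      have "\<forall>\<^sub>F u in G. \<forall>y\<in>Y. \<bar>u y - f y\<bar> < \<delta> / 2"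
      proof (intro eventually_ball_finite Y(2) ballI)
        fix y
        show "\<forall>\<^sub>F u in G. \<bar>u y - f y\<bar> < \<delta> / 2"
          using tendstoD[OF ev[of y], of "\<delta> / 2"] \<delta> by (simp add: dist_real_def)
      qed
      \<comment> \<open>\<open>G\<close> refines the image of the sequence, so a function close to
        the limit can be taken to be an actual blow-up, at a scale \<open>1/2^n\<close> as small as
        desired.\<close>
      moreover have "\<forall>\<^sub>F u in G. \<exists>n\<ge>N. u = w n"
        by (rule filter_leD[OF G(2)])
           (auto simp: F_def eventually_filtermap eventually_sequentially)
      ultimately have "\<forall>\<^sub>F u in G. (\<forall>y\<in>Y. \<bar>u y - f y\<bar> < \<delta> / 2) \<and> (\<exists>n\<ge>N. u = w n)"
        by (rule eventually_conj)
      then obtain n where n: "n \<ge> N" and near: "\<And>y. y \<in> Y \<Longrightarrow> \<bar>w n y - f y\<bar> < \<delta> / 2"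
        using eventually_happens'[OF G(1)] by blast
      have close: "\<bar>w n z - f z\<bar> \<le> \<delta>" if z: "norm z \<le> 1" for z
      proof -
        from z Y(3) obtain y where y: "y \<in> Y" "norm (y - z) < \<kappa>"
          by (auto simp: dist_norm)
        then have y1: "norm y \<le> 1" using Y(1) by auto
        have "2 * M * norm (y - z) \<le> 2 * M * \<kappa>"
          using y M0 by (intro mult_left_mono) auto
        also have "\<dots> \<le> \<delta> / 4" using M0 \<delta> by (simp add: \<kappa>_def field_simps)
        finally have "2 * M * norm (y - z) \<le> \<delta> / 4" .
        then show ?thesis
          using lip[OF w_conv w_bound y1 z, of n] lip[OF f_conv f_bound y1 z] near[OF y(1)]
          by linarith
      qed
      have "\<bar>g y - g x - q \<bullet> (y - x) - b (y - x) (y - x) / 2\<bar> \<le> \<delta> * (1/2^n)\<^sup>2"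
        if "norm (y - x) \<le> 1/2^n" for y
      proof -
        define z where "z = 2^n *\<^sub>R (y - x)"
        have zy: "(1/2^n) *\<^sub>R z = y - x" by (simp add: z_def)
        have e4: "(2::real)^n * 2^n = 4^n" by (simp flip: power_mult_distrib)
        have "norm z = 2^n * norm (y - x)" by (simp only: z_def norm_scaleR) simp
        then have "norm z \<le> 1" using that by (simp add: field_simps)
        moreover have "w n z = 4^n * (g y - g x - q \<bullet> (y - x))" unfolding w_def zy by simp
        moreover have "f z = 4^n * (b (y - x) (y - x) / 2)"
          by (simp add: b(3) z_def bilinear_lmul[OF b(1)] bilinear_rmul[OF b(1)] mult.assoc[symmetric] e4)
        ultimately have "\<bar>4^n * (g y - g x - q \<bullet> (y - x)) - 4^n * (b (y - x) (y - x) / 2)\<bar> \<le> \<delta>"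
          using close[of z] by simp
        then have "4^n * \<bar>g y - g x - q \<bullet> (y - x) - b (y - x) (y - x) / 2\<bar> \<le> \<delta>"
          by (simp add: right_diff_distrib[symmetric] abs_mult del: times_divide_eq_right)
        moreover have "(1/2^n)\<^sup>2 = 1 / (4::real)^n"
          by (simp add: power2_eq_square e4[symmetric])
        ultimately show ?thesis by (simp add: field_simps)
      qed
      moreover have "1 / 2^n < r0"
        using n N by (smt (verit) frac_le one_le_numeral power_increasing zero_less_power)
      ultimately show "\<exists>r b. 0 < r \<and> r < r0 \<and> bilinear b \<and> (\<forall>y z. b y z = b z y) \<and>
         (\<forall>y. norm (y - x) \<le> r \<longrightarrow> \<bar>g y - g x - q \<bullet> (y - x) - b (y - x) (y - x) / 2\<bar> \<le> \<delta> * r\<^sup>2)"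
        using b by (intro exI[of _ "1/2^n"] exI[of _ b]) auto
    qed
  qed
qed

section \<open>Semicontinuity, contact points and envelopes\<close>

lemma usc_on_iff_open:
  "usc_on S f \<longleftrightarrow> (\<forall>x\<in>S. \<forall>a. f x < a \<longrightarrow> (\<exists>T. open T \<and> x \<in> T \<and> (\<forall>y\<in>S \<inter> T. f y < a)))"
proof -
  have "(\<forall>\<^sub>F y in at x within S. f y < a) \<longleftrightarrow> (\<exists>T. open T \<and> x \<in> T \<and> (\<forall>y\<in>S \<inter> T. f y < a))"
    if "f x < a" for x a
    unfolding eventually_at_topological using that by (intro ex_cong1) auto
  then show ?thesis unfolding usc_on_def by (simp cong: ball_cong imp_cong)
qed

lemma usc_on_add_continuous:
  fixes f g :: "'a::topological_space \<Rightarrow> real"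
  assumes f: "usc_on S f" and g: "continuous_on S g"
  shows "usc_on S (\<lambda>x. f x + g x)"
  unfolding usc_on_def
proof (intro ballI allI impI)
  fix x a assume x: "x \<in> S" "f x + g x < a"
  define e where "e = (a - f x - g x) / 2"
  have "\<forall>\<^sub>F y in at x within S. f y < f x + e"
    using f x unfolding usc_on_def e_def by simp
  moreover have "\<forall>\<^sub>F y in at x within S. g y < g x + e"
    using g x by (intro order_tendstoD(2)[of g "g x"]) (auto simp: continuous_on_def e_def)
  ultimately show "\<forall>\<^sub>F y in at x within S. f y + g y < a"
  proof eventually_elim
    case (elim y)
    moreover have "e + e = a - f x - g x" by (simp add: e_def)
    ultimately show ?case by linarith
  qed
qed

lemma usc_on_Times:
  fixes f :: "'a::topological_space \<Rightarrow> real" and g :: "'b::topological_space \<Rightarrow> real"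
  assumes f: "usc_on S f" and g: "usc_on T g"
  shows "usc_on (S \<times> T) (\<lambda>p. f (fst p) + g (snd p))"
  unfolding usc_on_iff_open
proof (intro ballI allI impI)
  fix p a assume p: "p \<in> S \<times> T" "f (fst p) + g (snd p) < a"
  define e where "e = (a - f (fst p) - g (snd p)) / 2"
  have e0: "e > 0" and pS: "fst p \<in> S" "snd p \<in> T" using p by (auto simp: e_def)
  obtain U where U: "open U" "fst p \<in> U" "\<forall>y\<in>S \<inter> U. f y < f (fst p) + e"
    using f[unfolded usc_on_iff_open, rule_format, OF pS(1), of "f (fst p) + e"] e0 by auto
  obtain V where V: "open V" "snd p \<in> V" "\<forall>y\<in>T \<inter> V. g y < g (snd p) + e"
    using g[unfolded usc_on_iff_open, rule_format, OF pS(2), of "g (snd p) + e"] e0 by auto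
  have e: "e + e = a - f (fst p) - g (snd p)" by (simp add: e_def)
  show "\<exists>W. open W \<and> p \<in> W \<and> (\<forall>y\<in>S \<times> T \<inter> W. f (fst y) + g (snd y) < a)"
  proof (intro exI[of _ "U \<times> V"] conjI ballI)
    fix y assume "y \<in> S \<times> T \<inter> U \<times> V"
    then have "f (fst y) < f (fst p) + e" "g (snd y) < g (snd p) + e"
      using U(3) V(3) by auto
    then show "f (fst y) + g (snd y) < a" using e by linarith
  qed (use U V in \<open>auto simp: open_Times mem_Times_iff\<close>)
qed

text \<open>Otherwise each \<open>x\<close> has a better point \<open>m x\<close>, and the
  neighbourhoods where \<open>f\<close> stays below \<open>f (m x)\<close> cover \<open>S\<close>.
  In a finite subcover the largest of the values \<open>f (m x)\<close> is attained at a point of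
  \<open>S\<close> that no member can contain.\<close>

lemma usc_on_attains_max:
  fixes f :: "'a::topological_space \<Rightarrow> real"
  assumes "compact S" "S \<noteq> {}" and f: "usc_on S f"
  obtains x where "x \<in> S" "\<And>y. y \<in> S \<Longrightarrow> f y \<le> f x"
proof (rule ccontr)
  assume "\<not> thesis"
  then have "\<forall>x\<in>S. \<exists>y\<in>S. f x < f y" using that by (auto simp: not_le[symmetric])
  then obtain m where m: "\<And>x. x \<in> S \<Longrightarrow> m x \<in> S" "\<And>x. x \<in> S \<Longrightarrow> f x < f (m x)" by metis
  then have "\<forall>x\<in>S. \<exists>T. open T \<and> x \<in> T \<and> (\<forall>y\<in>S \<inter> T. f y < f (m x))"
    using f unfolding usc_on_iff_open by blast
  then obtain T where T: "\<And>x. x \<in> S \<Longrightarrow> open (T x)" "\<And>x. x \<in> S \<Longrightarrow> x \<in> T x"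
      "\<And>x y. x \<in> S \<Longrightarrow> y \<in> S \<Longrightarrow> y \<in> T x \<Longrightarrow> f y < f (m x)"
    by (metis IntI)
  obtain C where C: "C \<subseteq> S" "finite C" "S \<subseteq> (\<Union>x\<in>C. T x)"
    by (rule compactE_image[OF \<open>compact S\<close>, of S T]) (use T in auto)
  have "C \<noteq> {}" using C \<open>S \<noteq> {}\<close> by auto
  then have "Max ((\<lambda>x. f (m x)) ` C) \<in> (\<lambda>x. f (m x)) ` C"
    using \<open>finite C\<close> by (intro Max_in) auto
  then obtain c where "c \<in> C" "f (m c) = Max ((\<lambda>x. f (m x)) ` C)" by auto
  then have c: "c \<in> C" "\<And>x. x \<in> C \<Longrightarrow> f (m x) \<le> f (m c)"
    using \<open>finite C\<close> by simp_all
  have "m c \<in> S" using m c C by blast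
  then obtain x where x: "x \<in> C" "m c \<in> T x" using C by blast
  then have "f (m c) < f (m x)" using T(3)[OF _ \<open>m c \<in> S\<close>] C by blast
  then show False using c(2)[OF x(1)] by simp
qed

lemma lsc_on_iff_usc_on_uminus: "lsc_on S u \<longleftrightarrow> usc_on S (\<lambda>x. - u x)"
proof -
  have "(\<forall>a. a < u x \<longrightarrow> (\<forall>\<^sub>F y in at x within S. a < u y))
      \<longleftrightarrow> (\<forall>a. - u x < a \<longrightarrow> (\<forall>\<^sub>F y in at x within S. - u y < a))" (is "(\<forall>a. ?P a) \<longleftrightarrow> (\<forall>a. ?Q a)") for x
  proof -
    have "?Q a \<longleftrightarrow> ?P (- a)" for a by (simp add: minus_less_iff[of "u x"] minus_less_iff[of "u _"])
    moreover have "?P a \<longleftrightarrow> ?P (- (- a))" for a by simp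
    ultimately show ?thesis by blast
  qed
  then show ?thesis by (simp add: lsc_on_def usc_on_def)
qed

text \<open>The supremum of \<open>doubled\<close> over \<open>y\<close> and \<open>y'\<close> is the sum of the sup-convolutions of \<open>v\<close> and
  \<open>w\<close> at \<open>x\<close>, tilted by \<open>p\<close>. The value of \<open>p\<close> in \<open>contact\<close> is the one forced by stationarity
  in \<open>x\<close>.\<close>

definition doubled ::
    "('a::real_inner \<Rightarrow> real) \<Rightarrow> ('a \<Rightarrow> real) \<Rightarrow> real \<Rightarrow> 'a \<Rightarrow> 'a \<Rightarrow> 'a \<Rightarrow> 'a \<Rightarrow> real" where
  "doubled v w a p y y' x
     = v y + w y' - a / 2 * (norm (y - x))\<^sup>2 - a / 2 * (norm (y' - x))\<^sup>2 - p \<bullet> x"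

definition contact ::
    "'a::real_inner set \<Rightarrow> ('a \<Rightarrow> real) \<Rightarrow> ('a \<Rightarrow> real) \<Rightarrow> real \<Rightarrow> 'a \<Rightarrow> 'a \<Rightarrow> 'a \<Rightarrow> 'a \<Rightarrow> bool" where
  "contact S v w a p x z z' \<longleftrightarrow> z \<in> S \<and> z' \<in> S \<and> p = a *\<^sub>R (z - x + (z' - x)) \<and>
     (\<forall>y\<in>S. \<forall>y'\<in>S. \<forall>\<xi>. doubled v w a p y y' \<xi> \<le> doubled v w a p z z' x)"

lemma contact_max:
  assumes "contact S v w a p x z z'" "y \<in> S" "y' \<in> S"
  shows "doubled v w a p y y' \<xi> \<le> doubled v w a p z z' x"
proof -
  have "\<forall>y\<in>S. \<forall>y'\<in>S. \<forall>\<xi>. doubled v w a p y y' \<xi> \<le> doubled v w a p z z' x"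
    using assms(1) unfolding contact_def by (elim conjE)
  then show ?thesis using assms(2,3) by blast
qed

lemma contact_points:
  assumes "contact S v w a p x z z'"
  shows "z \<in> S" "z' \<in> S" "p = a *\<^sub>R (z - x + (z' - x))"
  using assms unfolding contact_def by auto

lemma norm_diff_shift_sq:
  fixes z :: "'a::real_inner"
  shows "(norm (z - (x + k)))\<^sup>2 = (norm (z - x))\<^sup>2 - 2 * ((z - x) \<bullet> k) + (norm k)\<^sup>2"
  by (simp add: power2_norm_eq_inner algebra_simps inner_commute)

text \<open>In its last variable \<open>doubled\<close> is a quadratic polynomial with Hessian
  \<open>- 2 * a\<close> times the identity, so this expansion is exact.\<close>

lemma doubled_shift:
  fixes z :: "'a::real_inner"
  shows "doubled v w a p z z' (x + k)
      = doubled v w a p z z' x + (a *\<^sub>R (z - x + (z' - x)) - p) \<bullet> k - a * (norm k)\<^sup>2"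
  unfolding doubled_def norm_diff_shift_sq by (simp add: algebra_simps)

lemma contact_exists:
  fixes S :: "'a::euclidean_space set"
  assumes S: "compact S" "S \<noteq> {}" and v: "usc_on S v" and w: "usc_on S w" and a: "0 < a"
  obtains x z z' where "contact S v w a p x z z'"
proof -
  \<comment> \<open>The maximiser in the last variable, explicit for fixed \<open>y\<close> and
    \<open>y'\<close>. Only a maximum over the compact set \<open>S \<times> S\<close> remains to be
    found.\<close>
  define m where "m y y' = (1/2) *\<^sub>R (y + y' - (1/a) *\<^sub>R p)" for y y' :: 'a
  have mp: "a *\<^sub>R (y - m y y' + (y' - m y y')) = p" for y y'
  proof -
    have "m y y' + m y y' = y + y' - (1/a) *\<^sub>R p"
      by (simp add: m_def flip: scaleR_left_distrib)
    then have "y - m y y' + (y' - m y y') = (1/a) *\<^sub>R p" by (simp add: algebra_simps)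
    then show ?thesis using a by simp
  qed
  have max: "doubled v w a p y y' \<xi> \<le> doubled v w a p y y' (m y y')" for y y' \<xi>
    using doubled_shift[of v w a p y y' "m y y'" "\<xi> - m y y'"] a mp[of y y'] by simp
  have "usc_on (S \<times> S) (\<lambda>p. v (fst p) + w (snd p))"
    by (rule usc_on_Times[OF v w])
  then have "usc_on (S \<times> S) (\<lambda>r. (v (fst r) + w (snd r)) +
      (- (a / 2 * (norm (fst r - m (fst r) (snd r)))\<^sup>2) - a / 2 * (norm (snd r - m (fst r) (snd r)))\<^sup>2
        - p \<bullet> m (fst r) (snd r)))"
    by (rule usc_on_add_continuous) (unfold m_def, intro continuous_intros)
  then have usc: "usc_on (S \<times> S) (\<lambda>r. doubled v w a p (fst r) (snd r) (m (fst r) (snd r)))"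
    by (simp add: doubled_def add_diff_eq)
  obtain r where r: "r \<in> S \<times> S" "\<And>r'. r' \<in> S \<times> S \<Longrightarrow>
      doubled v w a p (fst r') (snd r') (m (fst r') (snd r'))
      \<le> doubled v w a p (fst r) (snd r) (m (fst r) (snd r))"
    by (rule usc_on_attains_max[OF compact_Times[OF S(1) S(1)] _ usc]) (use S in auto)
  have "contact S v w a p (m (fst r) (snd r)) (fst r) (snd r)"
    unfolding contact_def
  proof (intro conjI ballI allI)
    fix y y' \<xi> assume "y \<in> S" "y' \<in> S"
    then show "doubled v w a p y y' \<xi> \<le> doubled v w a p (fst r) (snd r) (m (fst r) (snd r))"
      using max[of y y' \<xi>] r(2)[of "(y, y')"] by simp
  qed (use r(1) mp in auto)
  then show ?thesis by (rule that)
qed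

text \<open>Each contact triple is inserted into the maximality of the other and the two
  inequalities are added. The direction of the estimate matters: the tilt is a Lipschitz function of
  the contact point, so that a null set of points could only produce a null set of tilts.\<close>

lemma contact_Lipschitz:
  fixes S :: "'a::real_inner set"
  assumes p: "contact S v w a p x z z'" and q: "contact S v w a q y t t'" and a: "0 < a"
  shows "norm (p - q) \<le> 4 * a * norm (x - y)"
proof (cases "p = q")
  case False
  define P where "P = norm (p - q)"
  have P: "P > 0" using False by (simp add: P_def)
  \<comment> \<open>The maximiser of the concave quadratic
    \<open>(q - p) \<bullet> k - a * (norm k)\<^sup>2\<close>, the gain from moving away from
    \<open>y\<close> under the tilt \<open>p\<close>.\<close>
  define k where "k = (1 / (2 * a)) *\<^sub>R (q - p)"
  have rep: "doubled v w a r y y' \<xi> = doubled v w a 0 y y' \<xi> - r \<bullet> \<xi>" for r y y' \<xi>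
    by (simp add: doubled_def)
  have A: "doubled v w a p t t' (y + k) \<le> doubled v w a p z z' x"
    by (intro contact_max[OF p] contact_points[OF q])
  have B: "doubled v w a q z z' x \<le> doubled v w a q t t' y"
    by (intro contact_max[OF q] contact_points[OF p])
  have "a *\<^sub>R (t - y + (t' - y)) = q" by (rule contact_points(3)[OF q, symmetric])
  then have "doubled v w a p t t' (y + k) = doubled v w a p t t' y + (q - p) \<bullet> k - a * (norm k)\<^sup>2"
    by (simp only: doubled_shift)
  with A B have "(q - p) \<bullet> k - a * (norm k)\<^sup>2 \<le> (p - q) \<bullet> (y - x)"
    unfolding rep[of p] rep[of q] by (simp add: algebra_simps)
  also have "\<dots> \<le> P * norm (x - y)"
    unfolding P_def using norm_cauchy_schwarz[of "p - q" "y - x"] by (simp add: norm_minus_commute)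
  also have "(q - p) \<bullet> k = P\<^sup>2 / (2 * a)"
    by (simp add: k_def P_def power2_norm_eq_inner[symmetric] norm_minus_commute)
  also have "a * (norm k)\<^sup>2 = P\<^sup>2 / (4 * a)"
    using a by (simp add: k_def P_def norm_minus_commute power_divide power_mult_distrib)
               (simp add: power2_eq_square)
  finally have "P * P \<le> P * (4 * a * norm (x - y))"
    using a by (simp add: field_simps power2_eq_square)
  then show ?thesis using P by (simp add: P_def)
qed (use a in simp)

text \<open>Every tilt in the ball has a contact point, so the ball lies in the Lipschitz image of
  this set, and Lipschitz maps between spaces of equal dimension preserve null sets.
  Non-negligibility makes sense whether or not the set is measurable.\<close>

lemma contact_set_not_negligible:
  fixes S :: "'a::euclidean_space set"
  assumes S: "compact S" "S \<noteq> {}" and v: "usc_on S v" and w: "usc_on S w"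
    and a: "0 < a" and \<rho>: "0 < \<rho>"
  shows "\<not> negligible {x. \<exists>p z z'. norm p < \<rho> \<and> contact S v w a p x z z'}"
proof
  let ?K = "{x. \<exists>p z z'. norm p < \<rho> \<and> contact S v w a p x z z'}"
  assume neg: "negligible ?K"
  define P where "P x = (SOME p. \<exists>z z'. contact S v w a p x z z')" for x
  have P: "\<exists>z z'. contact S v w a (P x) x z z'" if "x \<in> ?K" for x
    unfolding P_def by (rule someI_ex) (use that in blast)
  have "negligible (P ` ?K)"
  proof (rule negligible_locally_Lipschitz_image[OF _ neg])
    fix x assume x: "x \<in> ?K"
    have "norm (P y - P x) \<le> 4 * a * norm (y - x)" if y: "y \<in> ?K" for y
    proof -
      obtain z z' t t' where "contact S v w a (P x) x z z'" "contact S v w a (P y) y t t'"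
        using P[OF x] P[OF y] by metis
      then show ?thesis by (intro contact_Lipschitz[OF _ _ a])
    qed
    then show "\<exists>T B. open T \<and> x \<in> T \<and> (\<forall>y\<in>?K \<inter> T. norm (P y - P x) \<le> B * norm (y - x))"
      by (intro exI[of _ UNIV] exI[of _ "4 * a"]) auto
  qed simp
  moreover have "ball 0 \<rho> \<subseteq> P ` ?K"
  proof
    fix p :: 'a assume p: "p \<in> ball 0 \<rho>"
    obtain x z z' where c: "contact S v w a p x z z'"
      using contact_exists[OF S v w a] by blast
    have x: "x \<in> ?K" using p c by auto
    obtain t t' where "contact S v w a (P x) x t t'" using P[OF x] by metis
    \<comment> \<open>With equal contact points the Lipschitz bound is 0: \<open>x\<close>
      determines its tilt, so the choice in \<open>P\<close> recovers \<open>p\<close>.\<close>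
    then have "norm (P x - p) \<le> 4 * a * norm (x - x)"
      using c by (rule contact_Lipschitz[OF _ _ a])
    then have "P x = p" by simp
    with x show "p \<in> P ` ?K" by blast
  qed
  ultimately have "negligible (ball (0::'a) \<rho>)" by (rule negligible_subset)
  then show False using \<rho> by (simp add: open_not_negligible)
qed

text \<open>The envelope is the infimum of the paraboloids of opening \<open>a\<close> above the sup-convolution of
  \<open>v\<close>. At a contact point it is squeezed between the sup-convolution of \<open>v\<close> and, up to
  an affine function, the negative of that of \<open>w\<close>.\<close>

definition admissible :: "'a::real_inner set \<Rightarrow> ('a \<Rightarrow> real) \<Rightarrow> real \<Rightarrow> (real \<times> 'a) set" where
  "admissible S v a = {(c, q). \<forall>z\<in>S. \<forall>y. v z - a / 2 * (norm (z - y))\<^sup>2 \<le> c + q \<bullet> y + a / 2 * (norm y)\<^sup>2}"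

definition envelope :: "'a::real_inner set \<Rightarrow> ('a \<Rightarrow> real) \<Rightarrow> real \<Rightarrow> 'a \<Rightarrow> real" where
  "envelope S v a x = (INF (c, q)\<in>admissible S v a. c + q \<bullet> x + a / 2 * (norm x)\<^sup>2)"

section \<open>Envelopes: bounds and two-sided regularity\<close>

lemma envelope_le:
  assumes "S \<noteq> {}" "(c, q) \<in> admissible S v a"
  shows "envelope S v a x \<le> c + q \<bullet> x + a / 2 * (norm x)\<^sup>2"
proof -
  obtain z where z: "z \<in> S" using assms by blast
  have "bdd_below ((\<lambda>(c, q). c + q \<bullet> x + a / 2 * (norm x)\<^sup>2) ` admissible S v a)"
    by (rule bdd_belowI[of _ "v z - a / 2 * (norm (z - x))\<^sup>2"]) (use z in \<open>auto simp: admissible_def\<close>)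
  from cINF_lower[OF this assms(2)] show ?thesis by (simp add: envelope_def)
qed

lemma envelope_greatest:
  assumes "admissible S v a \<noteq> {}"
    and "\<And>c q. (c, q) \<in> admissible S v a \<Longrightarrow> l \<le> c + q \<bullet> x + a / 2 * (norm x)\<^sup>2"
  shows "l \<le> envelope S v a x"
  unfolding envelope_def using assms by (intro cINF_greatest) auto

lemma admissible_nonempty:
  assumes "\<And>z. z \<in> S \<Longrightarrow> v z \<le> M" "0 \<le> a"
  shows "admissible S v a \<noteq> {}"
proof -
  have "(M, 0) \<in> admissible S v a"
    unfolding admissible_def
  proof (clarsimp)
    fix z y assume "z \<in> S"
    moreover have "0 \<le> a * (norm (z - y))\<^sup>2" "0 \<le> a * (norm y)\<^sup>2" using assms(2) by simp_all
    ultimately show "v z - a * (norm (z - y))\<^sup>2 / 2 \<le> M + a * (norm y)\<^sup>2 / 2"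
      using assms(1)[of z] by linarith
  qed
  then show ?thesis by blast
qed

lemma envelope_ge:
  assumes "admissible S v a \<noteq> {}" "z \<in> S"
  shows "v z - a / 2 * (norm (z - x))\<^sup>2 \<le> envelope S v a x"
  by (rule envelope_greatest[OF assms(1)]) (use assms(2) in \<open>auto simp: admissible_def\<close>)

text \<open>All competing paraboloids have the same quadratic part; without it the envelope is an
  infimum of affine functions, hence concave.\<close>

lemma envelope_semiconcave:
  assumes "S \<noteq> {}" and ne: "admissible S v a \<noteq> {}"
  shows "convex_on UNIV (\<lambda>x. a / 2 * (norm x)\<^sup>2 - envelope S v a x)"
proof (rule convex_onI)
  fix t :: real and x y :: 'a
  assume t: "0 < t" "t < 1"
  define u where "u = (1 - t) *\<^sub>R x + t *\<^sub>R y"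
  have "(1 - t) * (envelope S v a x - a / 2 * (norm x)\<^sup>2) + t * (envelope S v a y - a / 2 * (norm y)\<^sup>2)
      + a / 2 * (norm u)\<^sup>2 \<le> envelope S v a u"
  proof (rule envelope_greatest[OF ne])
    fix c q assume cq: "(c, q) \<in> admissible S v a"
    have "(1 - t) * (envelope S v a x - a / 2 * (norm x)\<^sup>2) \<le> (1 - t) * (c + q \<bullet> x)"
      using envelope_le[OF assms(1) cq, of x] t by (intro mult_left_mono) auto
    moreover have "t * (envelope S v a y - a / 2 * (norm y)\<^sup>2) \<le> t * (c + q \<bullet> y)"
      using envelope_le[OF assms(1) cq, of y] t by (intro mult_left_mono) auto
    moreover have "(1 - t) * (c + q \<bullet> x) + t * (c + q \<bullet> y) = c + q \<bullet> u"
      by (simp add: u_def inner_add_right algebra_simps)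
    ultimately show "(1 - t) * (envelope S v a x - a / 2 * (norm x)\<^sup>2)
        + t * (envelope S v a y - a / 2 * (norm y)\<^sup>2) + a / 2 * (norm u)\<^sup>2
        \<le> c + q \<bullet> u + a / 2 * (norm u)\<^sup>2" by linarith
  qed
  then show "a / 2 * (norm ((1 - t) *\<^sub>R x + t *\<^sub>R y))\<^sup>2 - envelope S v a ((1 - t) *\<^sub>R x + t *\<^sub>R y)
      \<le> (1 - t) * (a / 2 * (norm x)\<^sup>2 - envelope S v a x) + t * (a / 2 * (norm y)\<^sup>2 - envelope S v a y)"
    unfolding u_def[symmetric] by (simp add: algebra_simps)
qed simp

text \<open>The mean of admissible paraboloids translated by \<open>h\<close> and \<open>- h\<close>, raised by \<open>a / 2 * (norm h)\<^sup>2\<close>,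
  is admissible, because sup-convolutions are semiconvex.\<close>

lemma envelope_semiconvex:
  assumes "S \<noteq> {}" and ne: "admissible S v a \<noteq> {}"
  shows "2 * envelope S v a x \<le> envelope S v a (x + h) + envelope S v a (x - h) + a * (norm h)\<^sup>2"
proof -
  have key: "2 * envelope S v a x \<le> (c + q \<bullet> (x + h) + a / 2 * (norm (x + h))\<^sup>2)
      + (c' + q' \<bullet> (x - h) + a / 2 * (norm (x - h))\<^sup>2) + a * (norm h)\<^sup>2"
    if cq: "(c, q) \<in> admissible S v a" and cq': "(c', q') \<in> admissible S v a" for c q c' q'
  proof -
    \<comment> \<open>The term \<open>a * (norm h)\<^sup>2\<close> has two halves: one from the
      parallelogram law for the translated paraboloids, one from the raise.\<close>
    define d where "d = (c + c' + (q - q') \<bullet> h) / 2 + a * (norm h)\<^sup>2"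
    define r where "r = (1/2) *\<^sub>R (q + q')"
    have par: "(norm (y + h))\<^sup>2 + (norm (y - h))\<^sup>2 = 2 * (norm y)\<^sup>2 + 2 * (norm h)\<^sup>2" for y
      by (simp add: power2_norm_eq_inner algebra_simps)
    have sum: "2 * (d + r \<bullet> y + a / 2 * (norm y)\<^sup>2) = (c + q \<bullet> (y + h) + a / 2 * (norm (y + h))\<^sup>2)
      + (c' + q' \<bullet> (y - h) + a / 2 * (norm (y - h))\<^sup>2) + a * (norm h)\<^sup>2" for y
    proof -
      have "a / 2 * (norm (y + h))\<^sup>2 + a / 2 * (norm (y - h))\<^sup>2 = a * (norm y)\<^sup>2 + a * (norm h)\<^sup>2"
        unfolding distrib_left[symmetric] par by (simp add: algebra_simps)
      then show ?thesis by (simp add: d_def r_def inner_add_left inner_add_right inner_diff_left inner_diff_right field_simps)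
    qed
    have "(d, r) \<in> admissible S v a"
      unfolding admissible_def
    proof (clarify)
      fix z y assume z: "z \<in> S"
      \<comment> \<open>Here \<open>H\<close> is \<open>a * (norm h)\<^sup>2\<close>, which the two
        translated downward paraboloids at \<open>z\<close> lose by the parallelogram law and the
        raise restores.\<close>
      have half: "u - m \<le> P" if "u - n1 \<le> P1" "u - n2 \<le> P2" "n1 + n2 = N + H" "m + m = N"
        "2 * P = P1 + P2 + H" for u n1 n2 P1 P2 N H m P :: real
        using that by linarith
      show "v z - a / 2 * (norm (z - y))\<^sup>2 \<le> d + r \<bullet> y + a / 2 * (norm y)\<^sup>2"
      proof (rule half[OF _ _ _ _ sum])
        show "v z - a / 2 * (norm (z - (y + h)))\<^sup>2 \<le> c + q \<bullet> (y + h) + a / 2 * (norm (y + h))\<^sup>2"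
          "v z - a / 2 * (norm (z - (y - h)))\<^sup>2 \<le> c' + q' \<bullet> (y - h) + a / 2 * (norm (y - h))\<^sup>2"
          using cq cq' z unfolding admissible_def by blast+
        show "a / 2 * (norm (z - (y + h)))\<^sup>2 + a / 2 * (norm (z - (y - h)))\<^sup>2
            = a * (norm (z - y))\<^sup>2 + a * (norm h)\<^sup>2"
          unfolding distrib_left[symmetric] using par[of "z - y"] by (simp add: algebra_simps)
      qed simp
    qed
    then show ?thesis
      unfolding sum[symmetric] by (intro mult_left_mono envelope_le[OF assms(1)]) auto
  qed
  have "2 * envelope S v a x - a * (norm h)\<^sup>2 - envelope S v a (x - h) \<le> envelope S v a (x + h)"
  proof (rule envelope_greatest[OF ne])
    fix c q assume cq: "(c, q) \<in> admissible S v a"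
    have "2 * envelope S v a x - a * (norm h)\<^sup>2 - (c + q \<bullet> (x + h) + a / 2 * (norm (x + h))\<^sup>2)
        \<le> envelope S v a (x - h)"
      by (rule envelope_greatest[OF ne]) (use key[OF cq] in \<open>force simp: algebra_simps\<close>)
    then show "2 * envelope S v a x - a * (norm h)\<^sup>2 - envelope S v a (x - h)
        \<le> c + q \<bullet> (x + h) + a / 2 * (norm (x + h))\<^sup>2" by linarith
  qed
  then show ?thesis by linarith
qed

text \<open>Maximality says that for each \<open>y\<close> the upward paraboloid centred at
  \<open>y\<close> in the second claim is admissible. For \<open>y = z'\<close> it meets at
  \<open>x\<close> the downward paraboloid centred at \<open>z\<close>, which lies below the
  envelope. Stationarity gives both the slope \<open>a *\<^sub>R (z - x)\<close> there, and the
  Taylor estimate follows from being trapped between them.\<close>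

lemma envelope_at_contact:
  fixes S :: "'a::real_inner set"
  assumes c: "contact S v w a p x z z'" and ne: "admissible S v a \<noteq> {}"
  defines "g \<equiv> envelope S v a"
  shows "g x = v z - a / 2 * (norm (z - x))\<^sup>2"
    and "\<And>y \<xi>. y \<in> S \<Longrightarrow> g \<xi> \<le> doubled v w a p z z' x + p \<bullet> \<xi> - w y + a / 2 * (norm (y - \<xi>))\<^sup>2"
    and "\<bar>g y - g x - (a *\<^sub>R (z - x)) \<bullet> (y - x)\<bar> \<le> a / 2 * (norm (y - x))\<^sup>2"
proof -
  have z: "z \<in> S" "z' \<in> S" and max: "\<And>y y' \<xi>. y \<in> S \<Longrightarrow> y' \<in> S \<Longrightarrow>
      doubled v w a p y y' \<xi> \<le> doubled v w a p z z' x"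
    and p: "p = a *\<^sub>R (z - x + (z' - x))"
    using contact_points[OF c] contact_max[OF c] by blast+
  show upper: "g \<xi> \<le> doubled v w a p z z' x + p \<bullet> \<xi> - w y + a / 2 * (norm (y - \<xi>))\<^sup>2"
    if y: "y \<in> S" for y \<xi>
  proof -
    define d where "d = doubled v w a p z z' x - w y + a / 2 * (norm y)\<^sup>2"
    have rep: "d + (p - a *\<^sub>R y) \<bullet> \<xi> + a / 2 * (norm \<xi>)\<^sup>2
        = doubled v w a p z z' x + p \<bullet> \<xi> - w y + a / 2 * (norm (y - \<xi>))\<^sup>2" for \<xi>
      unfolding d_def power2_norm_eq_inner by (simp add: algebra_simps inner_commute)
    have "(d, p - a *\<^sub>R y) \<in> admissible S v a"
      unfolding admissible_def
    proof (clarify)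
      fix t \<xi> assume "t \<in> S"
      then have "doubled v w a p t y \<xi> \<le> doubled v w a p z z' x" using max y by blast
      then show "v t - a / 2 * (norm (t - \<xi>))\<^sup>2 \<le> d + (p - a *\<^sub>R y) \<bullet> \<xi> + a / 2 * (norm \<xi>)\<^sup>2"
        unfolding rep by (simp add: doubled_def)
    qed
    from envelope_le[OF _ this, of \<xi>] z show ?thesis unfolding g_def rep by blast
  qed
  have lower: "v z - a / 2 * (norm (z - \<xi>))\<^sup>2 \<le> g \<xi>" for \<xi>
    unfolding g_def by (rule envelope_ge[OF ne z(1)])
  show eq: "g x = v z - a / 2 * (norm (z - x))\<^sup>2"
    using lower[of x] upper[OF z(2), of x] by (simp add: doubled_def)
  have 1: "(norm (z - y))\<^sup>2 = (norm (z - x))\<^sup>2 - 2 * ((z - x) \<bullet> (y - x)) + (norm (y - x))\<^sup>2"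
    using norm_diff_shift_sq[of z x "y - x"] by simp
  have 2: "(norm (z' - y))\<^sup>2 = (norm (z' - x))\<^sup>2 - 2 * ((z' - x) \<bullet> (y - x)) + (norm (y - x))\<^sup>2"
    using norm_diff_shift_sq[of z' x "y - x"] by simp
  have "g y \<ge> g x + (a *\<^sub>R (z - x)) \<bullet> (y - x) - a / 2 * (norm (y - x))\<^sup>2"
    using lower[of y] unfolding eq 1 by (simp add: algebra_simps)
  moreover have "g y \<le> g x + (a *\<^sub>R (z - x)) \<bullet> (y - x) + a / 2 * (norm (y - x))\<^sup>2"
  proof -
    have "g y \<le> g x + (p - a *\<^sub>R (z' - x)) \<bullet> (y - x) + a / 2 * (norm (y - x))\<^sup>2"
      using upper[OF z(2), of y] unfolding eq 2 doubled_def by (simp add: algebra_simps)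
    moreover have "p - a *\<^sub>R (z' - x) = a *\<^sub>R (z - x)" by (simp add: p algebra_simps)
    ultimately show ?thesis by simp
  qed
  ultimately show "\<bar>g y - g x - (a *\<^sub>R (z - x)) \<bullet> (y - x)\<bar> \<le> a / 2 * (norm (y - x))\<^sup>2"
    by (simp only: abs_le_iff) linarith
qed

section \<open>Test functions near contact points\<close>

lemma linear_functional_eq_inner:
  fixes f :: "'a::euclidean_space \<Rightarrow> real"
  assumes "linear f"
  shows "\<exists>q. \<forall>k. f k = q \<bullet> k"
  using adjoint_works[OF assms, of _ 1] by (intro exI[of _ "adjoint f 1"]) (simp add: inner_commute)

text \<open>A second-order superjet with an exact local inequality instead of an error term. The
  slope is existential because the equation sees only Hessians.\<close>

definition touched_above :: "'a::real_inner set \<Rightarrow> ('a \<Rightarrow> real) \<Rightarrow> 'a \<Rightarrow> ('a \<Rightarrow> real) \<Rightarrow> bool" where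
  "touched_above S v s \<beta> \<longleftrightarrow> s \<in> S \<and> (\<exists>\<epsilon>>0. \<exists>q. \<forall>y\<in>S. norm (y - s) < \<epsilon> \<longrightarrow>
     v y \<le> v s + q \<bullet> (y - s) + \<beta> (y - s) / 2)"

text \<open>Adding \<open>4 * \<delta> * (norm (\<xi> - x))\<^sup>2\<close> to a quadratic that is \<open>\<delta> * r\<^sup>2\<close>-close on the ball of
  radius \<open>r\<close> forces an interior contact; one scale \<open>r\<close> therefore suffices.\<close>

lemma touched_by_quadratic:
  fixes S :: "'a::euclidean_space set"
  assumes S: "compact S" and v: "usc_on S v" and z: "z \<in> S" and r: "0 < r" and \<delta>: "0 < \<delta>"
    and b: "bilinear b" "\<And>y y'. b y y' = b y' y"
    and touch: "v z - a / 2 * (norm (z - x))\<^sup>2 = c"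
    and above: "\<And>y \<xi>. y \<in> S \<Longrightarrow> norm (\<xi> - x) \<le> r \<Longrightarrow>
        v y - a / 2 * (norm (y - \<xi>))\<^sup>2 \<le> c + q \<bullet> (\<xi> - x) + b (\<xi> - x) (\<xi> - x) / 2 + \<delta> * r\<^sup>2"
  shows "\<exists>s \<xi>. norm (\<xi> - x) < r
    \<and> c + q \<bullet> (\<xi> - x) + b (\<xi> - x) (\<xi> - x) / 2 \<le> v s - a / 2 * (norm (s - \<xi>))\<^sup>2
    \<and> touched_above S v s (\<lambda>k. b k k + 8 * \<delta> * (norm k)\<^sup>2)"
proof -
  \<comment> \<open>Any factor above 1 in place of 4 would beat the error on the sphere of radius
    \<open>r\<close>; the factor 1/2 in \<open>touched_above\<close> turns 4 into 8.\<close>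
  define Q where "Q \<xi> = c + q \<bullet> (\<xi> - x) + b (\<xi> - x) (\<xi> - x) / 2 + 4 * \<delta> * (norm (\<xi> - x))\<^sup>2" for \<xi>
  have bcont: "continuous_on UNIV (\<lambda>y. b y y)"
    using b(1) unfolding bilinear_conv_bounded_bilinear
    by (rule bounded_bilinear.continuous_on) (rule continuous_on_id)+
  have Qcont: "continuous_on UNIV Q"
    unfolding Q_def by (intro continuous_intros continuous_on_compose2[OF bcont]) auto
  have "usc_on (cball x r) (\<lambda>_. 0::real)" by (simp add: usc_on_def)
  from usc_on_Times[OF v this]
  have "usc_on (S \<times> cball x r) (\<lambda>p. (v (fst p) + 0) + (- (a / 2 * (norm (fst p - snd p))\<^sup>2) - Q (snd p)))"
    by (rule usc_on_add_continuous)
       (intro continuous_intros continuous_on_compose2[OF Qcont], auto)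
  then have usc: "usc_on (S \<times> cball x r) (\<lambda>p. v (fst p) - a / 2 * (norm (fst p - snd p))\<^sup>2 - Q (snd p))"
    by (simp add: add_diff_eq)
  obtain p where p: "p \<in> S \<times> cball x r" "\<And>p'. p' \<in> S \<times> cball x r \<Longrightarrow>
      v (fst p') - a / 2 * (norm (fst p' - snd p'))\<^sup>2 - Q (snd p')
      \<le> v (fst p) - a / 2 * (norm (fst p - snd p))\<^sup>2 - Q (snd p)"
    by (rule usc_on_attains_max[OF compact_Times[OF S compact_cball] _ usc]) (use z r in auto)
  obtain s \<xi> where s: "p = (s, \<xi>)" by (cases p)
  have sS: "s \<in> S" and \<xi>r: "norm (\<xi> - x) \<le> r" using p(1) s by (auto simp: dist_norm norm_minus_commute)
  have max: "v y - a / 2 * (norm (y - \<eta>))\<^sup>2 - Q \<eta> \<le> v s - a / 2 * (norm (s - \<xi>))\<^sup>2 - Q \<xi>"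
    if "y \<in> S" "norm (\<eta> - x) \<le> r" for y \<eta>
    using p(2)[of "(y, \<eta>)"] that s by (simp add: dist_norm norm_minus_commute)
  have "b 0 0 = 0" using b(1) by (rule bilinear_lzero)
  then have "Q x = c" by (simp add: Q_def)
  with max[OF z, of x] touch r have ge: "Q \<xi> \<le> v s - a / 2 * (norm (s - \<xi>))\<^sup>2" by simp
  have lt: "norm (\<xi> - x) < r"
  proof (rule ccontr)
    assume "\<not> norm (\<xi> - x) < r"
    with \<xi>r have eq: "norm (\<xi> - x) = r" by simp
    have "4 * \<delta> * r\<^sup>2 \<le> \<delta> * r\<^sup>2" using ge above[OF sS \<xi>r] unfolding Q_def eq by linarith
    then show False using \<delta> r by simp
  qed
  have "linear (\<lambda>k. b (\<xi> - x) k)" using b(1) by (simp add: bilinear_def)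
  from linear_functional_eq_inner[OF this] obtain q1 where q1: "\<And>k. b (\<xi> - x) k = q1 \<bullet> k" by blast
  define q' where "q' = q + q1 + (8 * \<delta>) *\<^sub>R (\<xi> - x)"
  \<comment> \<open>Moving \<open>s\<close> and \<open>\<xi>\<close> by the same \<open>k\<close>
    leaves the penalty unchanged, so the test from above passes from the sup-convolution at
    \<open>\<xi>\<close> to \<open>v\<close> at \<open>s\<close> with the same Hessian. The margin
    left inside the ball is the admissible size of \<open>k\<close>.\<close>
  have "touched_above S v s (\<lambda>k. b k k + 8 * \<delta> * (norm k)\<^sup>2)"
    unfolding touched_above_def
  proof (intro conjI exI[of _ "r - norm (\<xi> - x)"] exI[of _ q'] ballI impI)
    fix y assume y: "y \<in> S" "norm (y - s) < r - norm (\<xi> - x)"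
    define k where "k = y - s"
    have "norm (\<xi> + k - x) \<le> norm (\<xi> - x) + norm k"
      using norm_triangle_ineq[of "\<xi> - x" k] by (simp add: algebra_simps)
    then have "norm (\<xi> + k - x) \<le> r" using y by (simp add: k_def)
    from max[OF y(1) this] have "v y \<le> v s + (Q (\<xi> + k) - Q \<xi>)"
      by (simp add: k_def algebra_simps)
    also have "Q (\<xi> + k) - Q \<xi> = q' \<bullet> k + (b k k + 8 * \<delta> * (norm k)\<^sup>2) / 2"
    proof -
      define D where "D = \<xi> - x"
      have e: "\<xi> + k - x = D + k" by (simp add: D_def)
      have 1: "b (D + k) (D + k) = b D D + 2 * (q1 \<bullet> k) + b k k"
      proof -
        have "b D k = q1 \<bullet> k" unfolding D_def by (rule q1)
        then show ?thesis
          by (simp only: bilinear_ladd[OF b(1)] bilinear_radd[OF b(1)] b(2)[of k D])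
      qed
      have 2: "(norm (D + k))\<^sup>2 = (norm D)\<^sup>2 + 2 * (D \<bullet> k) + (norm k)\<^sup>2"
        unfolding power2_norm_eq_inner by (simp add: inner_add_left inner_add_right inner_commute[of k D])
      have 3: "q' \<bullet> k = q \<bullet> k + q1 \<bullet> k + 8 * \<delta> * (D \<bullet> k)"
        by (simp add: q'_def D_def inner_add_left)
      show ?thesis
        unfolding Q_def e D_def[symmetric] inner_add_right 1 2 3 by (simp add: field_simps)
    qed
    finally show "v y \<le> v s + q' \<bullet> (y - s) + (b (y - s) (y - s) + 8 * \<delta> * (norm (y - s))\<^sup>2) / 2"
      by (simp add: k_def add.assoc)
  qed (use sS lt in auto)
  moreover have "c + q \<bullet> (\<xi> - x) + b (\<xi> - x) (\<xi> - x) / 2 \<le> v s - a / 2 * (norm (s - \<xi>))\<^sup>2"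
  proof -
    have "0 \<le> 4 * \<delta> * (norm (\<xi> - x))\<^sup>2" using \<delta> by simp
    then show ?thesis using ge unfolding Q_def by linarith
  qed
  ultimately show ?thesis using lt by blast
qed

text \<open>A non-negligible contact set cannot lie inside the exceptional null set. At a contact
  point outside it, one scale and one form \<open>b\<close> serve \<open>v\<close> through the lower
  bound of the envelope and, with the sign reversed, \<open>w\<close> through the upper
  bound.\<close>

lemma jets_near_contact:
  fixes S :: "'a::euclidean_space set"
  assumes S: "compact S" "S \<noteq> {}" and v: "usc_on S v" and w: "usc_on S w"
    and a: "0 < a" and \<rho>: "0 < \<rho>" and \<kappa>: "0 < \<kappa>" and \<delta>: "0 < \<delta>"
  shows "\<exists>p x z z' s \<xi> t \<eta> b. norm p < \<rho> \<and> contact S v w a p x z z'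
    \<and> norm (\<xi> - x) < \<kappa> \<and> norm (\<eta> - x) < \<kappa> \<and> bilinear b \<and> (\<forall>y y'. b y y' = b y' y)
    \<and> v z - a / 2 * (norm (z - x))\<^sup>2 + (w z' - a / 2 * (norm (z' - x))\<^sup>2) - \<kappa>
      \<le> v s - a / 2 * (norm (s - \<xi>))\<^sup>2 + (w t - a / 2 * (norm (t - \<eta>))\<^sup>2)
    \<and> touched_above S v s (\<lambda>k. b k k + 8 * \<delta> * (norm k)\<^sup>2)
    \<and> touched_above S w t (\<lambda>k. - b k k + 8 * \<delta> * (norm k)\<^sup>2)"
proof -
  obtain z0 where z0: "\<And>z. z \<in> S \<Longrightarrow> v z \<le> v z0"
    using usc_on_attains_max[OF S v] by blast
  have ne: "admissible S v a \<noteq> {}" by (rule admissible_nonempty[OF z0]) (use a in auto)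
  define g where "g = envelope S v a"
  \<comment> \<open>The slope and the admissible scale depend on the contact point, which is found
    only after the null set is fixed; hence they are quantified inside.\<close>
  define good where "good x \<longleftrightarrow> (\<forall>q \<delta> r0.
    (\<forall>y. \<bar>g y - g x - q \<bullet> (y - x)\<bar> \<le> a / 2 * (norm (y - x))\<^sup>2) \<longrightarrow> 0 < \<delta> \<longrightarrow> 0 < r0 \<longrightarrow>
    (\<exists>r b. 0 < r \<and> r < r0 \<and> bilinear b \<and> (\<forall>y z. b y z = b z y) \<and>
       (\<forall>y. norm (y - x) \<le> r \<longrightarrow> \<bar>g y - g x - q \<bullet> (y - x) - b (y - x) (y - x) / 2\<bar> \<le> \<delta> * r\<^sup>2)))" for x
  have "AE x in lborel. good x"
    unfolding good_def g_def
    by (rule AE_quadratic_at_some_scale[OF envelope_semiconcave[OF S(2) ne] envelope_semiconvex[OF S(2) ne]])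
       (use a in simp)
  then obtain N where N: "N \<in> null_sets lborel" "{x. \<not> good x} \<subseteq> N"
    unfolding eventually_ae_filter by auto
  have "negligible N"
    using N(1) by (simp add: negligible_iff_null_sets null_sets_completionI)
  then have "\<not> {x. \<exists>p z z'. norm p < \<rho> \<and> contact S v w a p x z z'} \<subseteq> N"
    using contact_set_not_negligible[OF S v w a \<rho>] negligible_subset by blast
  then obtain x p z z' where p: "norm p < \<rho>" and c: "contact S v w a p x z z'" and good: "good x"
    using N(2) by blast
  have z: "z \<in> S" "z' \<in> S" using c by (auto simp: contact_def)
  define q where "q = a *\<^sub>R (z - x)"
  have taylor: "\<bar>g y - g x - q \<bullet> (y - x)\<bar> \<le> a / 2 * (norm (y - x))\<^sup>2" for y
    unfolding g_def q_def by (rule envelope_at_contact(3)[OF c ne])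
  have gx: "v z - a / 2 * (norm (z - x))\<^sup>2 = g x"
    unfolding g_def by (rule envelope_at_contact(1)[OF c ne, symmetric])
  \<comment> \<open>Collects the losses of value on both sides per unit of \<open>r\<close>;
    \<open>r < 1\<close> allows \<open>r\<^sup>2\<close> to be replaced by \<open>r\<close>. The
    summand 1 makes \<open>B\<close> positive.\<close>
  define B where "B = 2 * norm q + norm p + a + 2 * \<delta> + 1"
  have B: "B \<ge> 1" using a \<delta> by (simp add: B_def)
  define r0 where "r0 = min 1 (min \<kappa> (\<kappa> / B))"
  have r0: "r0 > 0" using \<kappa> B by (simp add: r0_def)
  obtain r b where r: "0 < r" "r < r0" and b: "bilinear b" "\<And>y z. b y z = b z y"
    and quad: "\<And>y. norm (y - x) \<le> r \<Longrightarrow> \<bar>g y - g x - q \<bullet> (y - x) - b (y - x) (y - x) / 2\<bar> \<le> \<delta> * r\<^sup>2"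
    using good[unfolded good_def, rule_format, OF taylor \<delta> r0] by blast
  have r\<kappa>: "r < \<kappa>" and r1: "r < 1" and rB: "B * r \<le> \<kappa>"
    using r B by (auto simp: r0_def field_simps)
  have "\<exists>s \<xi>. norm (\<xi> - x) < r
      \<and> g x + q \<bullet> (\<xi> - x) + b (\<xi> - x) (\<xi> - x) / 2 \<le> v s - a / 2 * (norm (s - \<xi>))\<^sup>2
      \<and> touched_above S v s (\<lambda>k. b k k + 8 * \<delta> * (norm k)\<^sup>2)"
  proof (rule touched_by_quadratic[OF S(1) v z(1) r(1) \<delta> b gx])
    fix y \<xi> assume "y \<in> S" "norm (\<xi> - x) \<le> r"
    then show "v y - a / 2 * (norm (y - \<xi>))\<^sup>2
        \<le> g x + q \<bullet> (\<xi> - x) + b (\<xi> - x) (\<xi> - x) / 2 + \<delta> * r\<^sup>2"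
      using envelope_ge[OF ne, of y \<xi>] quad[of \<xi>] unfolding g_def by linarith
  qed
  then obtain s \<xi> where s: "norm (\<xi> - x) < r"
      "g x + q \<bullet> (\<xi> - x) + b (\<xi> - x) (\<xi> - x) / 2 \<le> v s - a / 2 * (norm (s - \<xi>))\<^sup>2"
    and s_above: "touched_above S v s (\<lambda>k. b k k + 8 * \<delta> * (norm k)\<^sup>2)"
    by blast
  define c' where "c' = w z' - a / 2 * (norm (z' - x))\<^sup>2"
  have b': "bilinear (\<lambda>y z. - b y z)"
    using b(1) unfolding bilinear_def by (auto intro: linear_compose_neg)
  have "\<exists>t \<eta>. norm (\<eta> - x) < r
      \<and> c' + (p - q) \<bullet> (\<eta> - x) + - b (\<eta> - x) (\<eta> - x) / 2 \<le> w t - a / 2 * (norm (t - \<eta>))\<^sup>2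
      \<and> touched_above S w t (\<lambda>k. - b k k + 8 * \<delta> * (norm k)\<^sup>2)"
  proof (rule touched_by_quadratic[OF S(1) w z(2) r(1) \<delta> b' _ c'_def[symmetric]])
    fix y \<eta> assume y: "y \<in> S" "norm (\<eta> - x) \<le> r"
    have "g \<eta> \<le> doubled v w a p z z' x + p \<bullet> \<eta> - w y + a / 2 * (norm (y - \<eta>))\<^sup>2"
      unfolding g_def by (rule envelope_at_contact(2)[OF c ne y(1)])
    moreover have "doubled v w a p z z' x = g x + c' - p \<bullet> x"
      unfolding doubled_def c'_def gx[symmetric] by simp
    ultimately show "w y - a / 2 * (norm (y - \<eta>))\<^sup>2
        \<le> c' + (p - q) \<bullet> (\<eta> - x) + - b (\<eta> - x) (\<eta> - x) / 2 + \<delta> * r\<^sup>2"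
      using quad[OF y(2)] by (simp add: inner_diff_left inner_diff_right abs_le_iff)
  qed (simp add: b(2))
  then obtain t \<eta> where t: "norm (\<eta> - x) < r"
      "c' + (p - q) \<bullet> (\<eta> - x) + - b (\<eta> - x) (\<eta> - x) / 2 \<le> w t - a / 2 * (norm (t - \<eta>))\<^sup>2"
    and t_above: "touched_above S w t (\<lambda>k. - b k k + 8 * \<delta> * (norm k)\<^sup>2)"
    by blast
  have small: "a / 2 * (norm (y - x))\<^sup>2 \<le> a / 2 * r" "\<delta> * r\<^sup>2 \<le> \<delta> * r" "\<bar>q \<bullet> (y - x)\<bar> \<le> norm q * r"
    "\<bar>p \<bullet> (y - x)\<bar> \<le> norm p * r" if y: "norm (y - x) < r" for y
  proof -
    have "r\<^sup>2 \<le> r" using r r1 by (simp add: power2_eq_square)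
    moreover have "(norm (y - x))\<^sup>2 \<le> r\<^sup>2" using y by (intro power_mono) auto
    ultimately show "a / 2 * (norm (y - x))\<^sup>2 \<le> a / 2 * r" "\<delta> * r\<^sup>2 \<le> \<delta> * r"
      using a \<delta> by (auto intro!: mult_left_mono)
    show "\<bar>q \<bullet> (y - x)\<bar> \<le> norm q * r" "\<bar>p \<bullet> (y - x)\<bar> \<le> norm p * r"
      using y by (auto intro!: order_trans[OF Cauchy_Schwarz_ineq2] mult_left_mono)
  qed
  \<comment> \<open>No bound on \<open>b\<close> is available, so the quadratic is compared with
    \<open>g\<close>, whose Taylor estimate at \<open>x\<close> is known.\<close>
  have v_ge: "g x - (norm q * r + a / 2 * r + \<delta> * r) \<le> v s - a / 2 * (norm (s - \<xi>))\<^sup>2"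
    using s(2) quad[OF less_imp_le[OF s(1)]] taylor[of \<xi>] small[OF s(1)] by linarith
  have "c' - (norm p * r + norm q * r + a / 2 * r + \<delta> * r) \<le> w t - a / 2 * (norm (t - \<eta>))\<^sup>2"
    using t(2) quad[OF less_imp_le[OF t(1)]] taylor[of \<eta>] small[OF t(1)]
    unfolding inner_diff_left[of p q] by linarith
  with v_ge have "g x + c' - (2 * norm q + norm p + a + 2 * \<delta>) * r
      \<le> v s - a / 2 * (norm (s - \<xi>))\<^sup>2 + (w t - a / 2 * (norm (t - \<eta>))\<^sup>2)"
    by (simp add: algebra_simps)
  moreover have "(2 * norm q + norm p + a + 2 * \<delta>) * r \<le> \<kappa>"
    using rB r by (simp add: B_def algebra_simps)
  ultimately have gap: "v z - a / 2 * (norm (z - x))\<^sup>2 + (w z' - a / 2 * (norm (z' - x))\<^sup>2) - \<kappa>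
      \<le> v s - a / 2 * (norm (s - \<xi>))\<^sup>2 + (w t - a / 2 * (norm (t - \<eta>))\<^sup>2)"
    unfolding gx c'_def[symmetric] by linarith
  have "norm (\<xi> - x) < \<kappa>" "norm (\<eta> - x) < \<kappa>" using s(1) t(1) r\<kappa> by auto
  with p c b gap s_above t_above show ?thesis by blast
qed

text \<open>The opening of the paraboloids is \<open>Suc n\<close>, its inverse \<open>e\<close>
  bounds the tilt and the localisation. Comparison with the value at \<open>x1\<close> bounds the
  penalties independently of \<open>n\<close>, which makes the distances of order
  \<open>sqrt e\<close>. In \<open>(2 * R + 2) * e\<close> the tilt costs \<open>2 * R + 1\<close>
  and the localisation 1.\<close>

lemma close_jets:
  fixes S :: "'a::euclidean_space set" and n :: nat
  assumes S: "compact S" and R: "\<And>y. y \<in> S \<Longrightarrow> norm y \<le> R" and v: "usc_on S v" and w: "usc_on S w"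
    and x1: "x1 \<in> S" and M: "\<And>y y'. y \<in> S \<Longrightarrow> y' \<in> S \<Longrightarrow> v y + w y' \<le> M" and \<delta>: "0 < \<delta>"
  defines "\<theta> \<equiv> v x1 + w x1" and "e \<equiv> inverse (real (Suc n))"
  shows "\<exists>s t b. bilinear b \<and> (\<forall>y y'. b y y' = b y' y)
    \<and> norm (s - t) \<le> 2 * sqrt (2 * (M - \<theta> + 2 * R + 2) * e) + 2 * e
    \<and> \<theta> - (2 * R + 2) * e \<le> v s + w t
    \<and> touched_above S v s (\<lambda>k. b k k + 8 * \<delta> * (norm k)\<^sup>2)
    \<and> touched_above S w t (\<lambda>k. - b k k + 8 * \<delta> * (norm k)\<^sup>2)"
proof -
  define a where "a = real (Suc n)"
  have a: "a \<ge> 1" by (simp add: a_def)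
  have e: "0 < e" "e \<le> 1" "a * e = 1" by (auto simp: e_def a_def field_simps)
  have a0: "0 < a" and Sne: "S \<noteq> {}" using a x1 by auto
  from jets_near_contact[OF S Sne v w a0 e(1) e(1) \<delta>]
  obtain p x z z' s \<xi> t \<eta> b where
    p: "norm p < e" and c: "contact S v w a p x z z'"
    and near: "norm (\<xi> - x) < e" "norm (\<eta> - x) < e"
    and b: "bilinear b" "\<forall>y y'. b y y' = b y' y"
    and gap: "v z - a / 2 * (norm (z - x))\<^sup>2 + (w z' - a / 2 * (norm (z' - x))\<^sup>2) - e
      \<le> v s - a / 2 * (norm (s - \<xi>))\<^sup>2 + (w t - a / 2 * (norm (t - \<eta>))\<^sup>2)"
    and jets: "touched_above S v s (\<lambda>k. b k k + 8 * \<delta> * (norm k)\<^sup>2)"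
      "touched_above S w t (\<lambda>k. - b k k + 8 * \<delta> * (norm k)\<^sup>2)"
    by blast
  have st: "s \<in> S" "t \<in> S" using jets by (simp_all add: touched_above_def)
  \<comment> \<open>The contact point ranges over the whole space; stationarity ties it to
    \<open>z\<close> and \<open>z'\<close> and so keeps it bounded.\<close>
  have x2: "a *\<^sub>R (2 *\<^sub>R x) = a *\<^sub>R (z + z') - p"
    by (subst contact_points(3)[OF c]) (simp add: algebra_simps scaleR_2)
  have "norm (a *\<^sub>R (2 *\<^sub>R x)) \<le> norm (a *\<^sub>R (z + z')) + norm p"
    unfolding x2 by (rule norm_triangle_ineq4)
  then have "a * (2 * norm x) \<le> a * norm (z + z') + norm p" using a by (simp add: mult.assoc)
  also have "\<dots> \<le> a * (R + R) + a * 1"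
    using R[OF contact_points(1)[OF c]] R[OF contact_points(2)[OF c]] p e a
    by (intro add_mono mult_left_mono norm_triangle_le) auto
  finally have "a * (2 * norm x) \<le> a * (2 * R + 1)" by (simp add: algebra_simps)
  then have xR: "norm x \<le> R + 1" using a by simp
  have "norm (x1 - x) \<le> R + (R + 1)"
    using R[OF x1] xR by (intro order_trans[OF norm_triangle_ineq4] add_mono)
  then have "norm p * norm (x1 - x) \<le> e * (2 * R + 1)"
    using p e by (intro mult_mono) auto
  then have "p \<bullet> (x1 - x) \<le> e * (2 * R + 1)"
    using norm_cauchy_schwarz[of p "x1 - x"] by linarith
  moreover have "\<theta> - p \<bullet> x1 \<le> doubled v w a p z z' x"
    using contact_max[OF c x1 x1, of x1] by (simp add: doubled_def \<theta>_def)
  ultimately have "\<theta> - e * (2 * R + 1)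
      \<le> v z - a / 2 * (norm (z - x))\<^sup>2 + (w z' - a / 2 * (norm (z' - x))\<^sup>2)"
    unfolding doubled_def inner_diff_right by linarith
  with gap have val: "\<theta> - (2 * R + 2) * e
      \<le> v s - a / 2 * (norm (s - \<xi>))\<^sup>2 + (w t - a / 2 * (norm (t - \<eta>))\<^sup>2)"
    by (simp add: algebra_simps)
  have pos: "0 \<le> a / 2 * (norm (s - \<xi>))\<^sup>2" "0 \<le> a / 2 * (norm (t - \<eta>))\<^sup>2" using a by simp_all
  have "R \<ge> 0" using R[OF x1] norm_ge_zero[of x1] by linarith
  then have eR: "(2 * R + 2) * e \<le> 2 * R + 2" using e by (intro mult_left_le) auto
  have root: "norm u \<le> sqrt (2 * (M - \<theta> + 2 * R + 2) * e)"
    if "a / 2 * (norm u)\<^sup>2 \<le> M - \<theta> + 2 * R + 2" for u :: 'a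
  proof (rule real_le_rsqrt)
    have "(a * e) * (norm u)\<^sup>2 \<le> 2 * (M - \<theta> + 2 * R + 2) * e"
      using mult_right_mono[OF that, of "2 * e"] e(1) by (simp add: algebra_simps)
    then show "(norm u)\<^sup>2 \<le> 2 * (M - \<theta> + 2 * R + 2) * e" by (simp add: e(3))
  qed
  have "norm (s - \<xi>) \<le> sqrt (2 * (M - \<theta> + 2 * R + 2) * e)"
    "norm (t - \<eta>) \<le> sqrt (2 * (M - \<theta> + 2 * R + 2) * e)"
    using val pos M[OF st] eR by (intro root, linarith)+
  moreover have "norm (s - t) \<le> norm (s - \<xi>) + norm (\<xi> - x) + norm (\<eta> - x) + norm (t - \<eta>)"
  proof -
    have "norm (s - t) = norm ((s - \<xi>) + (\<xi> - x) - (\<eta> - x) - (t - \<eta>))" by simp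
    then show ?thesis
      using norm_triangle_ineq4[of "(s - \<xi>) + (\<xi> - x) - (\<eta> - x)" "t - \<eta>"]
        norm_triangle_ineq4[of "(s - \<xi>) + (\<xi> - x)" "\<eta> - x"]
        norm_triangle_ineq[of "s - \<xi>" "\<xi> - x"] by linarith
  qed
  ultimately have "norm (s - t) \<le> 2 * sqrt (2 * (M - \<theta> + 2 * R + 2) * e) + 2 * e"
    using near by linarith
  moreover have "\<theta> - (2 * R + 2) * e \<le> v s + w t" using val pos by linarith
  ultimately show ?thesis
    using b jets by (intro exI[of _ s] exI[of _ t] exI[of _ b] conjI)
qed

section \<open>Symmetric matrices and quadratic test functions\<close>

lemma bilinear_eq_matrix:
  fixes b :: "real ^ 'n \<Rightarrow> real ^ 'n \<Rightarrow> real"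
  assumes b: "bilinear b" "\<And>y z. b y z = b z y"
  shows "\<exists>X\<in>sym_matrices. \<forall>y z. b y z = y \<bullet> (X *v z)"
proof -
  define T where "T z = (\<chi> i. b (axis i 1) z)" for z
  have "linear T"
    unfolding T_def by (intro linearI) (auto simp: vec_eq_iff bilinear_radd[OF b(1)] bilinear_rmul[OF b(1)])
  then have T: "matrix T *v z = T z" for z by simp
  have eq: "b y z = y \<bullet> (matrix T *v z)" for y z
  proof -
    have lin: "linear (\<lambda>y. b y z)" using b(1) by (simp add: bilinear_def)
    have "b y z = b (\<Sum>i\<in>UNIV. (y $ i) *\<^sub>R axis i 1) z"
      using basis_expansion[of y] by (simp add: scalar_mult_eq_scaleR)
    also have "\<dots> = (\<Sum>i\<in>UNIV. y $ i * b (axis i 1) z)"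
      by (simp only: linear_sum[OF lin] linear_cmul[OF lin] real_scaleR_def)
    finally show ?thesis by (simp add: T inner_vec_def) (simp add: T_def)
  qed
  have "transpose (matrix T) = matrix T"
    by (simp add: vec_eq_iff transpose_def matrix_def T_def b(2))
  then show ?thesis using eq by (intro bexI[of _ "matrix T"]) (auto simp: sym_matrices_def)
qed

lemma quadratic_test_function:
  fixes Y :: "real ^ 'n ^ 'n" and q s :: "real ^ 'n" and c :: real
  assumes Y: "Y \<in> sym_matrices"
  defines "\<phi> \<equiv> \<lambda>y. c + q \<bullet> (y - s) + (y - s) \<bullet> (Y *v (y - s)) / 2"
  shows "C2_near \<phi> s" "hessian \<phi> s = Y"
proof -
  have Ysym: "y \<bullet> (Y *v z) = z \<bullet> (Y *v y)" for y z
  proof -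
    have "y \<bullet> (Y *v z) = (transpose Y *v y) \<bullet> z"
      by (simp only: dot_lmul_matrix[symmetric] transpose_matrix_vector)
    also have "transpose Y = Y" using Y by (simp add: sym_matrices_def)
    finally show ?thesis by (simp only: inner_commute)
  qed
  have Yij: "Y $ i $ j = Y $ j $ i" for i j
    using Y by (auto simp: sym_matrices_def transpose_def vec_eq_iff)
  have mv: "((\<lambda>y. Y *v (y - s)) has_derivative (\<lambda>k. Y *v k)) (at x)" for x
    by (rule bounded_linear.has_derivative[OF matrix_vector_mul_bounded_linear])
       (auto intro!: derivative_eq_intros)
  have d\<phi>: "(\<phi> has_derivative (\<lambda>k. (q + Y *v (x - s)) \<bullet> k)) (at x)" for x
  proof -
    have "(\<phi> has_derivative (\<lambda>k. q \<bullet> k + ((x - s) \<bullet> (Y *v k) + k \<bullet> (Y *v (x - s))) / 2)) (at x)"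
      unfolding \<phi>_def by (auto intro!: derivative_eq_intros mv)
    moreover have "(\<lambda>k. q \<bullet> k + ((x - s) \<bullet> (Y *v k) + k \<bullet> (Y *v (x - s))) / 2)
        = (\<lambda>k. (q + Y *v (x - s)) \<bullet> k)"
      using Ysym[of "x - s"] by (simp add: inner_add_left inner_add_right inner_commute)
    ultimately show ?thesis by simp
  qed
  have p\<phi>: "partial_derivative i \<phi> = (\<lambda>x. q $ i + (Y *v (x - s)) $ i)" for i
    unfolding partial_derivative_def
    by (simp add: fun_eq_iff frechet_derivative_at[OF d\<phi>, symmetric] inner_axis)
  have dp: "(partial_derivative i \<phi> has_derivative (\<lambda>k. (Y *v k) $ i)) (at x)" for i x
    unfolding p\<phi>
    using bounded_linear.has_derivative[OF bounded_linear_vec_nth mv]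
    by (auto intro!: derivative_eq_intros)
  have pp: "partial_derivative j (partial_derivative i \<phi>) = (\<lambda>x. Y $ i $ j)" for i j
  proof
    fix x
    have "partial_derivative j (partial_derivative i \<phi>) x = (Y *v axis j 1) $ i"
      unfolding partial_derivative_def[of j]
      by (simp add: frechet_derivative_at[OF dp, symmetric])
    then show "partial_derivative j (partial_derivative i \<phi>) x = Y $ i $ j"
      by (simp add: matrix_vector_mult_basis column_def)
  qed
  show "hessian \<phi> s = Y" by (simp add: hessian_def pp vec_eq_iff Yij)
  show "C2_near \<phi> s"
    unfolding C2_near_def
  proof (intro exI[of _ UNIV] conjI allI ballI)
    show "\<phi> differentiable (at x)" "partial_derivative i \<phi> differentiable (at x)" for x i
      using d\<phi> dp by (auto simp: differentiable_def)
    show "continuous_on UNIV (partial_derivative i (partial_derivative j \<phi>))" for i j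
      by (simp add: pp)
  qed auto
qed

lemma eq_op_nonneg_iff: "0 \<le> eq_op F f X x \<longleftrightarrow> ereal (f x) \<le> F X"
  by (cases "F X") (auto simp: eq_op_def)

lemma eq_op_nonpos_iff: "eq_op F f X x \<le> 0 \<longleftrightarrow> F X \<le> ereal (f x)"
  by (cases "F X") (auto simp: eq_op_def)

lemma add_scaleR_mat_sym: "X \<in> sym_matrices \<Longrightarrow> X + c *\<^sub>R mat 1 \<in> sym_matrices"
  by (auto simp: sym_matrices_def transpose_def vec_eq_iff mat_def)

lemma add_scaleR_mat_mult_vec:
  fixes X :: "real ^ 'n ^ 'n"
  shows "(X + c *\<^sub>R mat 1) *v y = X *v y + c *\<^sub>R y"
  by (simp add: matrix_vector_mult_add_rdistrib flip: scaleR_matrix_vector_assoc)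

lemma psd_le_add_scaleR_mat:
  fixes X :: "real ^ 'n ^ 'n"
  assumes "0 \<le> c"
  shows "psd_le X (X + c *\<^sub>R mat 1)"
proof -
  have "(X + c *\<^sub>R mat 1 - X) *v \<xi> = c *\<^sub>R \<xi>" for \<xi>
    using add_scaleR_mat_mult_vec[of 0 c \<xi>] by simp
  then show ?thesis using assms by (simp add: psd_le_def)
qed

section \<open>The comparison principle\<close>

theorem proposition2p7:
  fixes \<Omega> :: "(real ^ 'n) set"
    and f :: "real ^ 'n \<Rightarrow> real"
    and F :: "real ^ 'n ^ 'n \<Rightarrow> ereal"
  assumes "open \<Omega>" and "bounded \<Omega>"
    and "continuous_on \<Omega> f"
    and "elliptic_at_0 \<Omega> (eq_op F f)"
    and "\<And>x. x \<in> \<Omega> \<Longrightarrow>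
           sym_boundary (Theta_plus (eq_op F f) x) = sym_boundary (Theta_minus (eq_op F f) x)"
    and "\<And>x. x \<in> \<Omega> \<Longrightarrow> sym_boundary (Theta_minus (eq_op F f) x) \<noteq> {}"
    and "\<And>x0 X \<tau>. x0 \<in> \<Omega> \<Longrightarrow> (\<And>k::nat. X k \<in> sym_matrices) \<Longrightarrow>
           (\<lambda>k. F (X k)) \<longlonglongrightarrow> ereal (f x0) \<Longrightarrow> (0::real) < \<tau> \<Longrightarrow>
           ereal (f x0) < liminf (\<lambda>k. F (X k + \<tau> *\<^sub>R mat 1))"
  shows "comparison_principle \<Omega> F f"
  unfolding comparison_principle_def
proof (intro allI impI ballI, elim conjE)
  fix v u x1
  assume sub: "viscosity_subsolution \<Omega> F f v" and super: "viscosity_supersolution \<Omega> F f u"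
    and bd: "\<forall>x\<in>frontier \<Omega>. v x \<le> u x" and x1: "x1 \<in> \<Omega>"
  show "v x1 \<le> u x1"
  proof (rule ccontr)
    assume "\<not> v x1 \<le> u x1"
    define S where "S = closure \<Omega>"
    have S: "compact S" using \<open>bounded \<Omega>\<close> by (simp add: S_def compact_closure)
    have sub\<Omega>: "\<Omega> \<subseteq> S" by (simp add: S_def closure_subset)
    have x1S: "x1 \<in> S" using x1 sub\<Omega> by blast
    obtain R where R: "\<And>y. y \<in> S \<Longrightarrow> norm y \<le> R"
      using compact_imp_bounded[OF S] by (auto simp: bounded_iff)
    \<comment> \<open>Small enough that the perturbation, at most
      \<open>\<tau> / 2 * R\<^sup>2\<close> on \<open>S\<close>, does not close the gap at
      \<open>x1\<close>; so the perturbed difference on the boundary stays below its value at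
      \<open>x1\<close>.\<close>
    define \<tau> where "\<tau> = (v x1 - u x1) / (R\<^sup>2 + 1)"
    have \<tau>: "0 < \<tau>" using \<open>\<not> v x1 \<le> u x1\<close> by (simp add: \<tau>_def add_nonneg_pos)
    define v' where "v' y = v y + \<tau> / 2 * (norm y)\<^sup>2" for y
    define w where "w y = - u y" for y
    have v': "usc_on S v'"
      unfolding v'_def using sub
      by (intro usc_on_add_continuous continuous_intros) (simp add: viscosity_subsolution_def S_def)
    have w: "usc_on S w"
      using super unfolding w_def viscosity_supersolution_def S_def by (simp add: lsc_on_iff_usc_on_uminus)
    define \<theta> where "\<theta> = v' x1 + w x1"
    have bd_lt: "v' y + w y < \<theta>" if y: "y \<in> S" "y \<notin> \<Omega>" for y
    proof -
      have "y \<in> frontier \<Omega>"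
        using y \<open>open \<Omega>\<close> by (simp add: S_def frontier_def interior_open)
      then have "v' y + w y \<le> \<tau> / 2 * (norm y)\<^sup>2" using bd by (simp add: v'_def w_def)
      also have "\<dots> \<le> \<tau> / 2 * R\<^sup>2" using R[OF y(1)] \<tau> by (intro mult_left_mono power_mono) auto
      also have "\<dots> < \<tau> * (R\<^sup>2 + 1)"
      proof -
        have "0 \<le> \<tau> * R\<^sup>2" using \<tau> by simp
        then show ?thesis using \<tau> by (simp add: distrib_left add_nonneg_pos)
      qed
      also have "\<tau> * (R\<^sup>2 + 1) = v x1 - u x1"
        using zero_le_power2[of R] by (simp add: \<tau>_def field_simps add_nonneg_eq_0_iff)
      also have "\<dots> \<le> \<theta>" using \<tau> by (simp add: \<theta>_def v'_def w_def)
      finally show ?thesis .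
    qed
    obtain m m' where m: "\<And>y. y \<in> S \<Longrightarrow> v' y \<le> v' m" "\<And>y. y \<in> S \<Longrightarrow> w y \<le> w m'"
      using usc_on_attains_max[OF S _ v'] usc_on_attains_max[OF S _ w] x1S by (metis empty_iff)
    define M where "M = v' m + w m'"
    have M: "v' y + w y' \<le> M" if "y \<in> S" "y' \<in> S" for y y'
      unfolding M_def by (intro add_mono m that)
    \<comment> \<open>Chosen so that the error \<open>8 * \<delta>\<close> in each Hessian is
      \<open>\<tau> / 4\<close>.\<close>
    define \<delta> where "\<delta> = \<tau> / 32"
    have \<delta>: "0 < \<delta>" using \<tau> by (simp add: \<delta>_def)
    define d where "d n = 2 * sqrt (2 * (M - \<theta> + 2 * R + 2) * inverse (real (Suc n)))
        + 2 * inverse (real (Suc n))" for n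
    \<comment> \<open>The shift \<open>\<tau> / 4 - \<tau>\<close> is the error minus the Hessian of
      the perturbation; \<open>- (\<tau> / 4)\<close> is the error after the sign change from
      \<open>w\<close> to \<open>u\<close>. The equations are conditional because \<open>s\<close>
      and \<open>t\<close> may still lie on the boundary.\<close>
    define J where "J n s t X \<longleftrightarrow> s \<in> S \<and> t \<in> S \<and> X \<in> sym_matrices \<and> norm (s - t) \<le> d n
        \<and> \<theta> - (2 * R + 2) * inverse (real (Suc n)) \<le> v' s + w t
        \<and> (s \<in> \<Omega> \<longrightarrow> ereal (f s) \<le> F (X + (\<tau> / 4 - \<tau>) *\<^sub>R mat 1))
        \<and> (t \<in> \<Omega> \<longrightarrow> F (X + (- (\<tau> / 4)) *\<^sub>R mat 1) \<le> ereal (f t))" for n s t X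
    have near: "\<forall>\<^sub>F y in nhds s. y \<in> S \<and> norm (y - s) < \<epsilon>" if "s \<in> \<Omega>" "0 < \<epsilon>" for s \<epsilon>
    proof -
      have "\<forall>\<^sub>F y in nhds s. y \<in> \<Omega>" using that \<open>open \<Omega>\<close> by (simp add: eventually_nhds_in_open)
      moreover have "\<forall>\<^sub>F y in nhds s. y \<in> ball s \<epsilon>"
        by (rule eventually_nhds_in_open) (use that in auto)
      ultimately show ?thesis
        by eventually_elim (use sub\<Omega> in \<open>auto simp: dist_norm norm_minus_commute\<close>)
    qed
    have touch_sub: "0 \<le> eq_op F f (hessian \<phi> x) x"
      if "x \<in> \<Omega>" "C2_near \<phi> x" "\<phi> x = v x" "\<forall>\<^sub>F y in nhds x. v y \<le> \<phi> y" for x \<phi>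
      using sub that unfolding viscosity_subsolution_def by auto
    have touch_super: "eq_op F f (hessian \<phi> x) x \<le> 0"
      if "x \<in> \<Omega>" "C2_near \<phi> x" "\<phi> x = u x" "\<forall>\<^sub>F y in nhds x. \<phi> y \<le> u y" for x \<phi>
      using super that unfolding viscosity_supersolution_def by auto
    have "\<exists>s t X. J n s t X" for n
    proof -
      have "\<exists>s t b. bilinear b \<and> (\<forall>y y'. b y y' = b y' y) \<and> norm (s - t) \<le> d n
          \<and> \<theta> - (2 * R + 2) * inverse (real (Suc n)) \<le> v' s + w t
          \<and> touched_above S v' s (\<lambda>k. b k k + 8 * \<delta> * (norm k)\<^sup>2)
          \<and> touched_above S w t (\<lambda>k. - b k k + 8 * \<delta> * (norm k)\<^sup>2)"
        unfolding \<theta>_def d_def by (rule close_jets[OF S R v' w x1S M \<delta>])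
      then obtain s t b where b: "bilinear b" "\<forall>y y'. b y y' = b y' y"
        and dist: "norm (s - t) \<le> d n"
        and val: "\<theta> - (2 * R + 2) * inverse (real (Suc n)) \<le> v' s + w t"
        and jets: "touched_above S v' s (\<lambda>k. b k k + 8 * \<delta> * (norm k)\<^sup>2)"
          "touched_above S w t (\<lambda>k. - b k k + 8 * \<delta> * (norm k)\<^sup>2)"
        by blast
      have st: "s \<in> S" "t \<in> S" using jets by (simp_all add: touched_above_def)
      obtain \<epsilon> q1 where \<epsilon>: "0 < \<epsilon>" and jv: "\<And>y. y \<in> S \<Longrightarrow> norm (y - s) < \<epsilon> \<Longrightarrow>
          v' y \<le> v' s + q1 \<bullet> (y - s) + (b (y - s) (y - s) + 8 * \<delta> * (norm (y - s))\<^sup>2) / 2"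
        using jets(1) unfolding touched_above_def by blast
      obtain \<epsilon>' q2 where \<epsilon>': "0 < \<epsilon>'" and jw: "\<And>y. y \<in> S \<Longrightarrow> norm (y - t) < \<epsilon>' \<Longrightarrow>
          w y \<le> w t + q2 \<bullet> (y - t) + (- b (y - t) (y - t) + 8 * \<delta> * (norm (y - t))\<^sup>2) / 2"
        using jets(2) unfolding touched_above_def by blast
      from bilinear_eq_matrix[OF b(1) b(2)[rule_format]]
      obtain X where X: "X \<in> sym_matrices" "\<And>y z. b y z = y \<bullet> (X *v z)" by auto
      have "ereal (f s) \<le> F (X + (\<tau> / 4 - \<tau>) *\<^sub>R mat 1)" if s: "s \<in> \<Omega>"
      proof -
        define Y where "Y = X + (\<tau> / 4 - \<tau>) *\<^sub>R mat 1"
        \<comment> \<open>The slope is corrected by \<open>\<tau> *\<^sub>R s\<close>, the gradient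
          of the perturbation at \<open>s\<close>.\<close>
        define \<phi> where "\<phi> = (\<lambda>y. v s + (q1 - \<tau> *\<^sub>R s) \<bullet> (y - s) + (y - s) \<bullet> (Y *v (y - s)) / 2)"
        have Y: "Y \<in> sym_matrices" unfolding Y_def by (rule add_scaleR_mat_sym[OF X(1)])
        have above: "\<forall>\<^sub>F y in nhds s. v y \<le> \<phi> y"
          using near[OF s \<epsilon>]
        proof eventually_elim
          case (elim y)
          define k where "k = y - s"
          have y: "y = s + k" by (simp add: k_def)
          have ny: "(norm y)\<^sup>2 = (norm s)\<^sup>2 + 2 * (s \<bullet> k) + (norm k)\<^sup>2"
            unfolding y power2_norm_eq_inner by (simp add: inner_add_left inner_add_right inner_commute[of k s])
          have "\<tau> / 2 * (norm y)\<^sup>2 = \<tau> / 2 * (norm s)\<^sup>2 + \<tau> * (s \<bullet> k) + \<tau> * (norm k)\<^sup>2 / 2"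
            unfolding ny by (simp add: algebra_simps)
          moreover have "v y + \<tau> / 2 * (norm y)\<^sup>2 \<le> v s + \<tau> / 2 * (norm s)\<^sup>2 + q1 \<bullet> k
              + (k \<bullet> (X *v k) + \<tau> * (norm k)\<^sup>2 / 4) / 2"
            using jv[of y] elim unfolding v'_def k_def X(2) \<delta>_def by simp
          moreover have "k \<bullet> (Y *v k) = k \<bullet> (X *v k) + \<tau> * (norm k)\<^sup>2 / 4 - \<tau> * (norm k)\<^sup>2"
            unfolding Y_def add_scaleR_mat_mult_vec inner_add_right power2_norm_eq_inner
            by (simp add: left_diff_distrib)
          moreover have "\<phi> y = v s + (q1 \<bullet> k - \<tau> * (s \<bullet> k)) + k \<bullet> (Y *v k) / 2"
            by (simp add: \<phi>_def k_def inner_diff_left)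
          \<comment> \<open>The inner products and squared norms are abstracted to variables, which
            leaves linear arithmetic.\<close>
          moreover have "a \<le> c" if "A = B + D + E / 2" "a + A \<le> d + B + q + (x + E / 4) / 2"
              "z = x + E / 4 - E" "c = d + (q - D) + z / 2" for a c d q x z A B D E :: real
            unfolding that(4,3) using that(1,2) by (simp add: field_simps)
          ultimately show "v y \<le> \<phi> y" by blast
        qed
        note test = quadratic_test_function[OF Y, of "v s" "q1 - \<tau> *\<^sub>R s" s, folded \<phi>_def]
        have "0 \<le> eq_op F f (hessian \<phi> s) s"
          by (rule touch_sub[OF s test(1) _ above]) (simp add: \<phi>_def)
        then show ?thesis by (simp only: test(2) eq_op_nonneg_iff Y_def)
      qed
      moreover have "F (X + (- (\<tau> / 4)) *\<^sub>R mat 1) \<le> ereal (f t)" if t: "t \<in> \<Omega>"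
      proof -
        define Y where "Y = X + (- (\<tau> / 4)) *\<^sub>R mat 1"
        define \<phi> where "\<phi> = (\<lambda>y. u t + (- q2) \<bullet> (y - t) + (y - t) \<bullet> (Y *v (y - t)) / 2)"
        have Y: "Y \<in> sym_matrices" unfolding Y_def by (rule add_scaleR_mat_sym[OF X(1)])
        have below: "\<forall>\<^sub>F y in nhds t. \<phi> y \<le> u y"
          using near[OF t \<epsilon>']
        proof eventually_elim
          case (elim y)
          have "(y - t) \<bullet> (Y *v (y - t)) = (y - t) \<bullet> (X *v (y - t)) - \<tau> / 4 * (norm (y - t))\<^sup>2"
            unfolding Y_def add_scaleR_mat_mult_vec inner_add_right power2_norm_eq_inner by simp
          then show "\<phi> y \<le> u y"
            using jw[of y] elim unfolding \<phi>_def X(2) w_def \<delta>_def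
            by (simp add: diff_divide_distrib add_divide_distrib)
        qed
        note test = quadratic_test_function[OF Y, of "u t" "- q2" t, folded \<phi>_def]
        have "eq_op F f (hessian \<phi> t) t \<le> 0"
          by (rule touch_super[OF t test(1) _ below]) (simp add: \<phi>_def)
        then show ?thesis by (simp only: test(2) eq_op_nonpos_iff Y_def)
      qed
      ultimately have "J n s t X" unfolding J_def using st X(1) dist val by blast
      then show ?thesis by blast
    qed
    then obtain s t X where J: "\<And>n. J n (s n) (t n) (X n)" by metis
    have s: "s n \<in> S" and t: "t n \<in> S" and X: "X n \<in> sym_matrices"
      and dist: "norm (s n - t n) \<le> d n"
      and val: "\<theta> - (2 * R + 2) * inverse (real (Suc n)) \<le> v' (s n) + w (t n)" for n
      using J[of n] unfolding J_def by auto
    have d0: "d \<longlonglongrightarrow> 2 * sqrt (2 * (M - \<theta> + 2 * R + 2) * 0) + 2 * 0"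
      unfolding d_def by (intro tendsto_intros LIMSEQ_inverse_real_of_nat)
    have st0: "(\<lambda>n. s n - t n) \<longlonglongrightarrow> 0"
      by (rule Lim_null_comparison[of _ d]) (use dist d0 in auto)
    obtain l r where l: "l \<in> S" "strict_mono r" "(s \<circ> r) \<longlonglongrightarrow> l"
      using S s unfolding compact_def by blast
    have sl: "(\<lambda>n. s (r n)) \<longlonglongrightarrow> l" using l(3) by (simp add: o_def)
    have "(\<lambda>n. s (r n) - (s (r n) - t (r n))) \<longlonglongrightarrow> l - 0"
      using LIMSEQ_subseq_LIMSEQ[OF st0 l(2)] by (intro tendsto_diff sl) (simp add: o_def)
    then have tl: "(\<lambda>n. t (r n)) \<longlonglongrightarrow> l" by simp
    have "\<theta> \<le> v' l + w l"
    proof (rule ccontr)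
      assume "\<not> \<theta> \<le> v' l + w l"
      \<comment> \<open>One third of the gap each for \<open>v'\<close>, for \<open>w\<close> and
        for the error in the value; upper semicontinuity at \<open>l\<close> controls the first
        two.\<close>
      define \<gamma> where "\<gamma> = (\<theta> - (v' l + w l)) / 3"
      have \<gamma>: "0 < \<gamma>" using \<open>\<not> \<theta> \<le> v' l + w l\<close> by (simp add: \<gamma>_def)
      have ev: "\<forall>\<^sub>F n in sequentially. h (x (r n)) < h l + \<gamma>"
        if h: "usc_on S h" and x: "\<And>n. x n \<in> S" "(\<lambda>n. x (r n)) \<longlonglongrightarrow> l" for h and x :: "nat \<Rightarrow> real ^ 'n"
      proof -
        obtain T where T: "open T" "l \<in> T" "\<forall>y\<in>S \<inter> T. h y < h l + \<gamma>"
          using h[unfolded usc_on_iff_open, rule_format, OF l(1), of "h l + \<gamma>"] \<gamma> by auto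
        show ?thesis
          using topological_tendstoD[OF x(2) T(1,2)]
        proof eventually_elim
          case (elim n)
          then show ?case using T(3) x(1)[of "r n"] by blast
        qed
      qed
      have "(\<lambda>n. (2 * R + 2) * inverse (real (Suc n))) \<longlonglongrightarrow> (2 * R + 2) * 0"
        by (intro tendsto_intros LIMSEQ_inverse_real_of_nat)
      from LIMSEQ_subseq_LIMSEQ[OF this l(2)]
      have "\<forall>\<^sub>F n in sequentially. (2 * R + 2) * inverse (real (Suc (r n))) < \<gamma>"
        using \<gamma> by (intro order_tendstoD(2)[of _ 0]) (auto simp: o_def)
      with ev[OF v' s sl] ev[OF w t tl] have "\<forall>\<^sub>F n in sequentially. False"
      proof eventually_elim
        case (elim n)
        have "3 * \<gamma> = \<theta> - (v' l + w l)" by (simp add: \<gamma>_def)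
        with elim val[of "r n"] show False by linarith
      qed
      then show False by simp
    qed
    then have l\<Omega>: "l \<in> \<Omega>" using bd_lt[OF l(1)] by (meson not_le)
    \<comment> \<open>The matrix of the subsolution; adding \<open>\<tau> / 2\<close> times the
      identity gives that of the supersolution.\<close>
    define Z where "Z n = X (r n) + (\<tau> / 4 - \<tau>) *\<^sub>R mat 1" for n
    have Zsym: "Z n \<in> sym_matrices" for n unfolding Z_def by (rule add_scaleR_mat_sym[OF X])
    have Z': "Z n + (\<tau> / 2) *\<^sub>R mat 1 = X (r n) + (- (\<tau> / 4)) *\<^sub>R mat 1" for n
    proof -
      have "(\<tau> / 4 - \<tau>) + \<tau> / 2 = - (\<tau> / 4)" by simp
      then show ?thesis unfolding Z_def add.assoc scaleR_left_distrib[symmetric] by (simp only:)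
    qed
    have in\<Omega>: "\<forall>\<^sub>F n in sequentially. s (r n) \<in> \<Omega> \<and> t (r n) \<in> \<Omega>"
      by (intro eventually_conj topological_tendstoD[OF sl] topological_tendstoD[OF tl] \<open>open \<Omega>\<close> l\<Omega>)
    have sandwich: "\<forall>\<^sub>F n in sequentially. ereal (f (s (r n))) \<le> F (Z n) \<and> F (Z n) \<le> ereal (f (t (r n)))
        \<and> F (Z n + (\<tau> / 2) *\<^sub>R mat 1) \<le> ereal (f (t (r n)))"
      using in\<Omega>
    proof eventually_elim
      case (elim n)
      define W where "W = Z n + (\<tau> / 2) *\<^sub>R mat 1"
      have W: "W \<in> sym_matrices" "psd_le (Z n) W"
        unfolding W_def using \<tau> by (auto intro: add_scaleR_mat_sym Zsym psd_le_add_scaleR_mat)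
      have lo: "ereal (f (s (r n))) \<le> F (Z n)" and up: "F W \<le> ereal (f (t (r n)))"
        using J[of "r n"] elim unfolding J_def W_def Z' unfolding Z_def by blast+
      \<comment> \<open>The contrapositive of strict ellipticity, at the point
        \<open>t (r n)\<close> for both matrices, carries the upper bound from \<open>W\<close> down
        to the smaller matrix \<open>Z n\<close>. The values \<open>F (Z n)\<close> are thus bounded
        on both sides.\<close>
      have "\<not> 0 < eq_op F f W (t (r n))" using up by (simp add: eq_op_nonpos_iff not_less)
      then have "\<not> 0 < eq_op F f (Z n) (t (r n))"
        using \<open>elliptic_at_0 \<Omega> (eq_op F f)\<close> elim W Zsym unfolding elliptic_at_0_def by blast
      then have "F (Z n) \<le> ereal (f (t (r n)))" by (simp add: eq_op_nonpos_iff not_less)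
      then show ?case using lo up unfolding W_def by blast
    qed
    have isCont: "isCont f l"
      using \<open>continuous_on \<Omega> f\<close> \<open>open \<Omega>\<close> l\<Omega> by (simp add: continuous_on_eq_continuous_at)
    have fs: "(\<lambda>n. ereal (f (s (r n)))) \<longlonglongrightarrow> ereal (f l)" and ft: "(\<lambda>n. ereal (f (t (r n)))) \<longlonglongrightarrow> ereal (f l)"
      using isCont_tendsto_compose[OF isCont sl] isCont_tendsto_compose[OF isCont tl] by simp_all
    have "(\<lambda>n. F (Z n)) \<longlonglongrightarrow> ereal (f l)"
      by (rule tendsto_sandwich[OF _ _ fs ft]) (use sandwich in \<open>auto elim: eventually_mono\<close>)
    then have "ereal (f l) < liminf (\<lambda>k. F (Z k + (\<tau> / 2) *\<^sub>R mat 1))"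
      using assms(7)[OF l\<Omega> Zsym] \<tau> by simp
    also have "\<dots> \<le> liminf (\<lambda>n. ereal (f (t (r n))))"
      by (rule Liminf_mono) (use sandwich in \<open>auto elim: eventually_mono\<close>)
    also have "\<dots> = ereal (f l)" using ft by (intro lim_imp_Liminf) auto
    finally show False by simp
  qed
qed

end
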